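(* The no-slip Sinai billiard, for any choice of scatterer curvature (i.e. for a circular scatterer of any radius $0<\rho<1/2$ in the unit flat torus), contains (linearly) elliptic periodic trajectories of period $2$.
   Context: No-slip planar billiard. A disc of radius $R>0$ with rotationally symmetric mass distribution moves so that its center stays in a region $\mathcal{B}$ (the billiard table). For the no-slip Sinai billiard, $\mathcal{B}$ is the complement in the flat torus $\mathbb{R}^2/\mathbb{Z}^2$ of an open round disc (scatterer) of radius $\rho$, $0<\rho<1/2$ (curvature $1/\rho$). The mass distribution enters through a parameter $\gamma\in(0,1]$ (moment of inertia $=m(\gamma R)^2$, where $m$ is the mass), equivalently the characteristic angle $\beta\in(0,\pi/2]$ with $\gamma=\tan(\beta/2)$. The configuration manifold is $M=\mathcal{B}\times\mathbb{T}$, $\mathbb{T}=\mathbb{R}/(2\pi\gamma R\,\mathbb{Z})$, where the $\mathbb{T}$-coordinate is $x=\gamma R\theta$ and $\theta$ is the moving disc's angle of orientation; $\partial M=\partial\mathcal{B}\times\mathbb{T}$. Tangent spaces of $M$ are identified with $\mathbb{R}^3$ with the standard inner product. At $q\in\partial M$, the product frame $(e_1,e_2(q),e_3(q))$ is the positively oriented orthonormal frame in which $e_1$ is the constant unit vector in the direction of $\mathbb{T}$, $e_2(q)$ is tangent to $\partial\mathcal{B}$, and $e_3(q)$ is the unit normal to $\partial M$ pointing into $M$. The no-slip collision map $C_q:\mathbb{R}^3\to\mathbb{R}^3$ is the linear map whose matrix in the product frame is $$\mathcal{C}=\begin{pmatrix}-\cos\beta&-\sin\beta&0\\-\sin\beta&\cos\beta&0\\0&0&-1\end{pmatrix}.$$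 The phase space is $N=\{(q,v): q\in\partial M,\ v\in\mathbb{R}^3,\ |v|=1,\ \langle v,e_3(q)\rangle>0\}$. The billiard map is $T(q,v)=(\tilde q,C_{\tilde q}v)$ with $\tilde q=q+tv$, $t=\inf\{s>0:q+sv\in\partial M\}$, where this makes sense and is smooth. Periodicity of period $2$ is understood in the reduced sense, or equivalently after lifting $\mathcal B$ and $\mathbb{T}$ to their universal covers: the lifted trajectory goes back and forth between two points on the boundary of the lifted table. For a period-2 state $\xi=(q,v)$ the eigenvalues of $dT^2_\xi$ on the 4-dimensional tangent space are either all real, of the form $1,1,r,1/r$, or $1,1,\lambda,\overline\lambda$ with $\lambda$ non-real and $|\lambda|=1$; $\xi$ is called (linearly) elliptic in the latter case, equivalently $|\mathrm{Tr}(dT^2_\xi)-2|<2$. *)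

theory Defs
  imports "HOL-Analysis.Analysis"
begin

text \<open>
  Everything is lifted to the cover \<open>\<real>\<^sup>2 \<times> \<real>\<close> of the configuration torus
  \<open>\<real>\<^sup>2/\<int>\<^sup>2 \<times> \<real>/(2\<pi>\<gamma>R\<int>)\<close>: a configuration \<open>q\<close> has table coordinates
  \<open>(q$1, q$2)\<close> and rotational coordinate \<open>q$3 = \<gamma>R\<theta>\<close>. The radius \<open>R\<close> of the moving disc
  enters only through the deck group (lemma \<open>billiard_map_deck\<close>).
\<close>

definition lattice :: "(real^2) set" where
  "lattice = {k. \<forall>i. k $ i \<in> \<int>}"

definition table :: "real \<Rightarrow> (real^2) set" where
  "table \<rho> = - (\<Union>k\<in>lattice. ball k \<rho>)"

definition planar :: "real^3 \<Rightarrow> real^2" where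
  "planar q = vector [q $ 1, q $ 2]"

definition bdry :: "real \<Rightarrow> (real^3) set" where
  "bdry \<rho> = {q. planar q \<in> frontier (table \<rho>)}"

definition centre :: "real \<Rightarrow> real^3 \<Rightarrow> real^2" where
  "centre \<rho> q = (THE k. k \<in> lattice \<and> dist (planar q) k = \<rho>)"

text \<open>
  The product frame. The coordinate orders \<open>(table, rotation)\<close> and \<open>(rotation, table)\<close> differ by
  a cyclic permutation, so they define the same orientation of \<open>\<real>\<^sup>3\<close>; taking \<open>e2\<close> to
  be \<open>e3 \<times> e1\<close> makes \<open>(e1, e2, e3)\<close> positively oriented.
\<close>

definition e1 :: "real^3" where
  "e1 = axis 3 1"

definition e3 :: "real \<Rightarrow> real^3 \<Rightarrow> real^3" where
  "e3 \<rho> q = (let n = (1 / \<rho>) *\<^sub>R (planar q - centre \<rho> q) in vector [n $ 1, n $ 2, 0])"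

definition e2 :: "real \<Rightarrow> real^3 \<Rightarrow> real^3" where
  "e2 \<rho> q = cross3 (e3 \<rho> q) e1"

definition frame :: "real \<Rightarrow> real^3 \<Rightarrow> real^3^3" where
  "frame \<rho> q = transpose (vector [e1, e2 \<rho> q, e3 \<rho> q])"

text \<open>The characteristic angle \<open>\<beta>\<close> is given by \<open>\<gamma> = tan (\<beta>/2)\<close>.\<close>

definition char_angle :: "real \<Rightarrow> real" where
  "char_angle \<gamma> = 2 * arctan \<gamma>"

definition collision_matrix :: "real \<Rightarrow> real^3^3" where
  "collision_matrix \<beta> = vector
    [vector [- cos \<beta>, - sin \<beta>, 0],
     vector [- sin \<beta>,   cos \<beta>, 0],
     vector [0, 0, -1]]"

text \<open>The frame is orthonormal, so \<open>transpose\<close> is the inverse in this change of basis.\<close>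

definition collision :: "real \<Rightarrow> real \<Rightarrow> real^3 \<Rightarrow> real^3 \<Rightarrow> real^3" where
  "collision \<rho> \<gamma> q v =
     (frame \<rho> q ** collision_matrix (char_angle \<gamma>) ** transpose (frame \<rho> q)) *v v"

type_synonym state = "(real^3) \<times> (real^3)"

definition phase_space :: "real \<Rightarrow> state set" where
  "phase_space \<rho> = {(q, v). q \<in> bdry \<rho> \<and> norm v = 1 \<and> v \<bullet> e3 \<rho> q > 0}"

definition hit_times :: "real \<Rightarrow> state \<Rightarrow> real set" where
  "hit_times \<rho> = (\<lambda>(q, v). {s. s > 0 \<and> q + s *\<^sub>R v \<in> bdry \<rho>})"

definition billiard_map :: "real \<Rightarrow> real \<Rightarrow> state \<Rightarrow> state" where
  "billiard_map \<rho> \<gamma> = (\<lambda>(q, v).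
     let q' = q + Inf (hit_times \<rho> (q, v)) *\<^sub>R v in (q', collision \<rho> \<gamma> q' v))"

text \<open>
  Since \<open>\<langle>C\<^sub>q v, e\<^sub>3\<rangle> = - \<langle>v, e\<^sub>3\<rangle>\<close>, the image is in the phase space exactly when the
  scatterer is hit transversally; the tangential hits so excluded are those where the map
  is not smooth.
\<close>

definition billiard_dom :: "real \<Rightarrow> real \<Rightarrow> state set" where
  "billiard_dom \<rho> \<gamma> =
     {\<xi> \<in> phase_space \<rho>. hit_times \<rho> \<xi> \<noteq> {} \<and> billiard_map \<rho> \<gamma> \<xi> \<in> phase_space \<rho>}"

definition period_2 :: "real \<Rightarrow> real \<Rightarrow> state \<Rightarrow> bool" where
  "period_2 \<rho> \<gamma> \<xi> \<longleftrightarrow>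
     \<xi> \<in> billiard_dom \<rho> \<gamma> \<and> billiard_map \<rho> \<gamma> \<xi> \<in> billiard_dom \<rho> \<gamma> \<and>
     billiard_map \<rho> \<gamma> \<xi> \<noteq> \<xi> \<and> billiard_map \<rho> \<gamma> (billiard_map \<rho> \<gamma> \<xi>) = \<xi>"

text \<open>The phase space is a 4-dimensional submanifold of \<open>\<real>\<^sup>3 \<times> \<real>\<^sup>3\<close>; this is its tangent space.\<close>

definition tangent_space :: "real \<Rightarrow> state \<Rightarrow> state set" where
  "tangent_space \<rho> = (\<lambda>(q, v). {(dq, dv). dq \<bullet> e3 \<rho> q = 0 \<and> dv \<bullet> v = 0})"

definition represents_on ::
    "real^'n^'n \<Rightarrow> ('a::real_vector \<Rightarrow> 'a) \<Rightarrow> 'a set \<Rightarrow> bool" where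
  "represents_on A D V \<longleftrightarrow>
     (\<exists>b :: 'n \<Rightarrow> 'a. inj b \<and> independent (range b) \<and> span (range b) = V \<and>
        (\<forall>j. D (b j) = (\<Sum>i\<in>UNIV. A $ i $ j *\<^sub>R b i)))"

text \<open>
  The derivative within the phase space is determined only on the tangent space, where it is
  \<open>dT\<^sup>2\<^sub>\<xi>\<close>. Its eigenvalues, with algebraic multiplicity, are \<open>1, 1, \<mu>, cnj \<mu>\<close>.
\<close>

definition elliptic :: "real \<Rightarrow> real \<Rightarrow> state \<Rightarrow> bool" where
  "elliptic \<rho> \<gamma> \<xi> \<longleftrightarrow>
     (\<exists>D (A :: real^4^4) \<mu>::complex.
        ((\<lambda>\<eta>. billiard_map \<rho> \<gamma> (billiard_map \<rho> \<gamma> \<eta>)) has_derivative D)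
          (at \<xi> within phase_space \<rho>) \<and>
        represents_on A D (tangent_space \<rho> \<xi>) \<and>
        (\<forall>z. det (mat z - (\<chi> i j. complex_of_real (A $ i $ j)))
               = (z - 1)^2 * (z - \<mu>) * (z - cnj \<mu>)) \<and>
        \<mu> \<notin> \<real> \<and> norm \<mu> = 1)"

lemma planar_add: "planar (p + q) = planar p + planar q"
  by (simp add: planar_def vec_eq_iff forall_2)

lemma planar_scaleR: "planar (c *\<^sub>R q) = c *\<^sub>R planar q"
  by (simp add: planar_def vec_eq_iff forall_2)

lemma lattice_add: "k \<in> lattice \<Longrightarrow> l \<in> lattice \<Longrightarrow> k + l \<in> lattice"
  by (simp add: lattice_def)

lemma lattice_diff: "k \<in> lattice \<Longrightarrow> l \<in> lattice \<Longrightarrow> k - l \<in> lattice"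
  by (simp add: lattice_def)

lemma lattice_dist_ge_1:
  assumes "k \<in> lattice" "l \<in> lattice" "k \<noteq> l"
  shows "dist k l \<ge> 1"
proof -
  obtain i where i: "k $ i \<noteq> l $ i" using assms(3) by (auto simp: vec_eq_iff)
  have "(k - l) $ i \<in> \<int>" using assms(1,2) by (simp add: lattice_def)
  then have "\<bar>(k - l) $ i\<bar> \<ge> 1" using i by (intro Ints_nonzero_abs_ge1) auto
  also have "\<bar>(k - l) $ i\<bar> \<le> norm (k - l)" by (rule component_le_norm_cart)
  finally show ?thesis by (simp add: dist_norm)
qed

lemma lattice_centre_unique:
  assumes "\<rho> < 1/2" "k \<in> lattice" "dist p k \<le> \<rho>" "l \<in> lattice" "dist p l \<le> \<rho>"
  shows "k = l"
proof (rule ccontr)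
  assume "k \<noteq> l"
  then have "1 \<le> dist k l" using assms lattice_dist_ge_1 by blast
  also have "\<dots> \<le> dist p k + dist p l" by (rule dist_triangle3)
  finally show False using assms by linarith
qed

lemma frontier_table:
  assumes "0 < \<rho>" "\<rho> < 1/2"
  shows "frontier (table \<rho>) = {p. \<exists>k\<in>lattice. dist p k = \<rho>}"
proof -
  let ?U = "\<Union>k\<in>lattice. ball k \<rho>"
  have cl: "closure ?U = (\<Union>k\<in>lattice. cball k \<rho>)"
  proof -
    have lf: "locally_finite_in euclidean ((\<lambda>k. ball k \<rho>) ` lattice)"
      unfolding locally_finite_in_def
    proof (intro conjI ballI)
      show "\<Union> ((\<lambda>k. ball k \<rho>) ` lattice) \<subseteq> topspace euclidean" by simp
    next
      fix p :: "real^2"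
      define e where "e = 1/2 - \<rho>"
      have "e > 0" using assms by (simp add: e_def)
      have one: "k = l" if "k \<in> lattice" "l \<in> lattice"
          "ball k \<rho> \<inter> ball p e \<noteq> {}" "ball l \<rho> \<inter> ball p e \<noteq> {}" for k l
      proof (rule ccontr)
        assume "k \<noteq> l"
        then have "1 \<le> dist k l" using that lattice_dist_ge_1 by blast
        moreover have d: "dist m p < 1/2" if "ball m \<rho> \<inter> ball p e \<noteq> {}" for m
        proof -
          obtain x where "dist m x < \<rho>" "dist p x < e" using \<open>ball m \<rho> \<inter> ball p e \<noteq> {}\<close> by auto
          then show ?thesis using dist_triangle2[of m p x] by (simp add: e_def)
        qed
        ultimately show False
          using d[OF that(3)] d[OF that(4)] dist_triangle2[of k l p] by linarith
      qed
      have "{U \<in> (\<lambda>k. ball k \<rho>) ` lattice. U \<inter> ball p e \<noteq> {}} \<subseteq>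
              {ball (SOME k. k \<in> lattice \<and> ball k \<rho> \<inter> ball p e \<noteq> {}) \<rho>}"
      proof clarify
        fix k x assume k: "k \<in> lattice" "ball k \<rho> \<inter> ball p e \<noteq> {}"
        then have "k = (SOME k. k \<in> lattice \<and> ball k \<rho> \<inter> ball p e \<noteq> {})"
          using one someI[where P = "\<lambda>k. k \<in> lattice \<and> ball k \<rho> \<inter> ball p e \<noteq> {}", of k] by blast
        then show "ball k \<rho> = ball (SOME k. k \<in> lattice \<and> ball k \<rho> \<inter> ball p e \<noteq> {}) \<rho>"
          by simp
      qed
      then have "finite {U \<in> (\<lambda>k. ball k \<rho>) ` lattice. U \<inter> ball p e \<noteq> {}}"
        using finite_subset by blast
      then show "\<exists>V. openin euclidean V \<and> p \<in> V \<and>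
                  finite {U \<in> (\<lambda>k. ball k \<rho>) ` lattice. U \<inter> V \<noteq> {}}"
        using \<open>e > 0\<close> by (intro exI[of _ "ball p e"]) auto
    qed
    have "closure ?U = \<Union> (closure ` ((\<lambda>k. ball k \<rho>) ` lattice))"
      using closure_of_locally_finite_Union[OF lf] by (simp add: image_image)
    also have "\<dots> = (\<Union>k\<in>lattice. cball k \<rho>)"
      using assms by (auto simp: image_image)
    finally show ?thesis .
  qed
  have "frontier (table \<rho>) = closure ?U - ?U"
    unfolding table_def frontier_complement by (simp add: frontier_def interior_open open_UN)
  also have "\<dots> = {p. \<exists>k\<in>lattice. dist p k = \<rho>}"
  proof (intro equalityI subsetI)
    fix p assume "p \<in> closure ?U - ?U"
    then show "p \<in> {p. \<exists>k\<in>lattice. dist p k = \<rho>}"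
      unfolding cl by (force simp: dist_commute)
  next
    fix p assume "p \<in> {p. \<exists>k\<in>lattice. dist p k = \<rho>}"
    then obtain k where k: "k \<in> lattice" "dist p k = \<rho>" by auto
    have "p \<notin> ball l \<rho>" if "l \<in> lattice" for l
    proof
      assume "p \<in> ball l \<rho>"
      then have l: "dist p l < \<rho>" by (simp add: dist_commute)
      have "k = l"
        by (rule lattice_centre_unique[OF assms(2) k(1) _ that, of p]) (use k(2) l in simp_all)
      with k(2) l show False by simp
    qed
    then show "p \<in> closure ?U - ?U"
      unfolding cl using k by (auto simp: dist_commute)
  qed
  finally show ?thesis .
qed

lemma bdry_iff:
  assumes "0 < \<rho>" "\<rho> < 1/2"
  shows "q \<in> bdry \<rho> \<longleftrightarrow> (\<exists>k\<in>lattice. dist (planar q) k = \<rho>)"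
  using assms by (simp add: bdry_def frontier_table)

lemma centre_eq:
  assumes "\<rho> < 1/2" "k \<in> lattice" "dist (planar q) k = \<rho>"
  shows "centre \<rho> q = k"
  unfolding centre_def
proof (rule the_equality)
  show "k \<in> lattice \<and> dist (planar q) k = \<rho>" using assms by blast
next
  fix l assume "l \<in> lattice \<and> dist (planar q) l = \<rho>"
  then show "l = k" by (intro lattice_centre_unique[OF assms(1), of l "planar q" k]) (simp_all add: assms)
qed

lemma frame_orthonormal:
  assumes "0 < \<rho>" "\<rho> < 1/2" "q \<in> bdry \<rho>"
  shows "norm e1 = 1" "norm (e2 \<rho> q) = 1" "norm (e3 \<rho> q) = 1"
    "e1 \<bullet> e2 \<rho> q = 0" "e1 \<bullet> e3 \<rho> q = 0" "e2 \<rho> q \<bullet> e3 \<rho> q = 0"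
    "cross3 (e2 \<rho> q) (e3 \<rho> q) = e1"
proof -
  obtain k where k: "k \<in> lattice" "dist (planar q) k = \<rho>"
    using assms by (auto simp: bdry_iff)
  define n where "n = (1 / \<rho>) *\<^sub>R (planar q - k)"
  have "norm n = 1" using k assms by (simp add: n_def dist_norm)
  then have n1: "(n $ 1)^2 + (n $ 2)^2 = 1"
    by (simp add: norm_eq_sqrt_inner inner_vec_def sum_2 power2_eq_square)
  have e3: "e3 \<rho> q = vector [n $ 1, n $ 2, 0]"
    using centre_eq[OF assms(2) k] by (simp add: e3_def n_def Let_def)
  have e1: "e1 = vector [0, 0, 1]"
    by (simp add: e1_def vec_eq_iff forall_3 axis_def)
  have e2: "e2 \<rho> q = vector [n $ 2, - n $ 1, 0]"
    by (simp add: e2_def e3 e1 cross3_def)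
  show "norm e1 = 1" "norm (e2 \<rho> q) = 1" "norm (e3 \<rho> q) = 1"
    "e1 \<bullet> e2 \<rho> q = 0" "e1 \<bullet> e3 \<rho> q = 0" "e2 \<rho> q \<bullet> e3 \<rho> q = 0"
    "cross3 (e2 \<rho> q) (e3 \<rho> q) = e1"
    using n1
    by (simp_all add: e1 e2 e3 cross3_def norm_eq_sqrt_inner inner_vec_def sum_3
        power2_eq_square add.commute)
qed

definition deck_group :: "real \<Rightarrow> real \<Rightarrow> (real^3) set" where
  "deck_group R \<gamma> = {d. planar d \<in> lattice \<and> (\<exists>n::int. d $ 3 = of_int n * (2 * pi * \<gamma> * R))}"

lemma bdry_deck:
  assumes "0 < \<rho>" "\<rho> < 1/2" "d \<in> deck_group R \<gamma>"
  shows "q + d \<in> bdry \<rho> \<longleftrightarrow> q \<in> bdry \<rho>"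
proof -
  have d: "planar d \<in> lattice" using assms by (simp add: deck_group_def)
  have "(\<exists>k\<in>lattice. dist (planar q + planar d) k = \<rho>) \<longleftrightarrow>
        (\<exists>k\<in>lattice. dist (planar q) k = \<rho>)"
  proof
    assume "\<exists>k\<in>lattice. dist (planar q + planar d) k = \<rho>"
    then obtain k where "k \<in> lattice" "dist (planar q + planar d) k = \<rho>" by blast
    then show "\<exists>k\<in>lattice. dist (planar q) k = \<rho>"
      using d by (intro bexI[of _ "k - planar d"]) (simp_all add: lattice_diff dist_norm algebra_simps)
  next
    assume "\<exists>k\<in>lattice. dist (planar q) k = \<rho>"
    then obtain k where "k \<in> lattice" "dist (planar q) k = \<rho>" by blast
    then show "\<exists>k\<in>lattice. dist (planar q + planar d) k = \<rho>"
      using d by (intro bexI[of _ "k + planar d"]) (simp_all add: lattice_add)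
  qed
  then show ?thesis using assms by (simp add: bdry_iff planar_add)
qed

lemma e3_deck:
  assumes "0 < \<rho>" "\<rho> < 1/2" "d \<in> deck_group R \<gamma>" "q \<in> bdry \<rho>"
  shows "e3 \<rho> (q + d) = e3 \<rho> q"
proof -
  have d: "planar d \<in> lattice" using assms by (simp add: deck_group_def)
  obtain k where k: "k \<in> lattice" "dist (planar q) k = \<rho>"
    using assms by (auto simp: bdry_iff)
  have "centre \<rho> (q + d) = k + planar d"
    using k d by (intro centre_eq assms) (simp_all add: lattice_add planar_add)
  then show ?thesis
    using centre_eq[OF assms(2) k] by (simp add: e3_def planar_add)
qed

lemma billiard_map_deck:
  assumes "0 < \<rho>" "\<rho> < 1/2" "d \<in> deck_group R \<gamma>" "(q, v) \<in> billiard_dom \<rho> \<gamma>"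
  shows "billiard_map \<rho> \<gamma> (q + d, v) =
           (fst (billiard_map \<rho> \<gamma> (q, v)) + d, snd (billiard_map \<rho> \<gamma> (q, v)))"
proof -
  have shift: "q + d + s *\<^sub>R v = (q + s *\<^sub>R v) + d" for s by simp
  have h: "hit_times \<rho> (q + d, v) = hit_times \<rho> (q, v)"
    unfolding hit_times_def split shift bdry_deck[OF assms(1-3)] ..
  define q' where "q' = q + Inf (hit_times \<rho> (q, v)) *\<^sub>R v"
  have "q' \<in> bdry \<rho>"
    using assms(4) by (auto simp: billiard_dom_def billiard_map_def phase_space_def q'_def Let_def)
  then have "collision \<rho> \<gamma> (q' + d) v = collision \<rho> \<gamma> q' v"
    using assms by (simp add: collision_def frame_def e2_def e3_deck)
  then show ?thesis
    by (simp add: billiard_map_def h Let_def shift flip: q'_def)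
qed

end

(*
  Consider trajectories moving horizontally between the scatterers centred at (0,0) and (1,0),
  leaving the first one at the point with outer normal (a, b), where a^2 + b^2 = 1. The planar speed
  and the spin can be balanced so that the velocity lies in the -1-eigenspace of both collision
  maps, which gives a one-parameter family of period-2 orbits. The reflection of the table in the
  line x = 1/2, combined with reversing the rotation, commutes with the billiard map T and exchanges
  the two collision points, so T^2 = F^2 where F is T followed by this reflection, and F fixes the
  orbit. Its derivative has eigenvalues -1 (rotation of the configuration), 1 (the family) and m, 1/m
  with m + 1/m = -2 + 2 a / (rho (1 + gamma^2)). Since rho < 1/2 and gamma <= 1, the choice
  a = rho (1 + gamma^2) / 2 is admissible, and then m is a primitive cube root of unity.
*)

theory Submission
  imports Defs
begin

section \<open>Collisions in coordinates\<close>

lemma dist_planar_eq_iff: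
  assumes "0 < \<rho>"
  shows "dist (planar q) k = \<rho> \<longleftrightarrow> (q$1 - k$1)\<^sup>2 + (q$2 - k$2)\<^sup>2 = \<rho>\<^sup>2"
proof -
  have "dist (planar q) k = sqrt ((q$1 - k$1)\<^sup>2 + (q$2 - k$2)\<^sup>2)"
    by (simp add: dist_norm norm_vec_def L2_set_def sum_2 planar_def)
  then show ?thesis
    using assms by (metis abs_of_pos real_sqrt_abs real_sqrt_eq_iff)
qed

lemma bdry_iff':
  assumes "0 < \<rho>" "\<rho> < 1/2"
  shows "q \<in> bdry \<rho> \<longleftrightarrow>
    (\<exists>k\<in>lattice. (q$1 - k$1)\<^sup>2 + (q$2 - k$2)\<^sup>2 = \<rho>\<^sup>2)"
  using bdry_iff[OF assms] dist_planar_eq_iff[OF assms(1)] by simp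

lemma e3_eq:
  assumes "0 < \<rho>" "\<rho> < 1/2" "k \<in> lattice" "(q$1 - k$1)\<^sup>2 + (q$2 - k$2)\<^sup>2 = \<rho>\<^sup>2"
  shows "e3 \<rho> q = vector [(q$1 - k$1) / \<rho>, (q$2 - k$2) / \<rho>, 0]"
proof -
  have "centre \<rho> q = k"
    using assms by (intro centre_eq) (auto simp: dist_planar_eq_iff)
  then show ?thesis
    by (simp add: e3_def Let_def planar_def)
qed

text \<open>Closed discs about distinct lattice points are disjoint, so any circle through
  \<open>q\<close> yields the normal \<open>e3\<close>; an existential over \<open>k\<close> can
  therefore replace the description operator in \<open>centre\<close>.\<close>

lemma phase_space_iff:
  assumes "0 < \<rho>" "\<rho> < 1/2"
  shows "(q, v) \<in> phase_space \<rho> \<longleftrightarrow> norm v = 1 \<and>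
    (\<exists>k\<in>lattice. (q$1 - k$1)\<^sup>2 + (q$2 - k$2)\<^sup>2 = \<rho>\<^sup>2 \<and>
       (q$1 - k$1) * v$1 + (q$2 - k$2) * v$2 > 0)"
proof -
  have "v \<bullet> e3 \<rho> q > 0 \<longleftrightarrow> (q$1 - k$1) * v$1 + (q$2 - k$2) * v$2 > 0"
    if "k \<in> lattice" "(q$1 - k$1)\<^sup>2 + (q$2 - k$2)\<^sup>2 = \<rho>\<^sup>2" for k
  proof -
    have "v \<bullet> e3 \<rho> q = ((q$1 - k$1) * v$1 + (q$2 - k$2) * v$2) / \<rho>"
      by (simp add: e3_eq[OF assms that] inner_vec_def sum_3 add_divide_distrib mult.commute)
    then show ?thesis
      using assms by (simp add: zero_less_divide_iff)
  qed
  then show ?thesis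
    by (auto simp: phase_space_def bdry_iff'[OF assms])
qed

text \<open>\<open>fixed_dir\<close> spans the \<open>+1\<close>-eigenspace of the collision map, which is minus the identity on
  its orthogonal complement.\<close>

definition fixed_dir :: "real \<Rightarrow> real \<Rightarrow> real^2 \<Rightarrow> real^3 \<Rightarrow> real^3" where
  "fixed_dir \<rho> \<gamma> k q = vector [(q$2 - k$2) / \<rho>, (k$1 - q$1) / \<rho>, - \<gamma>]"

text \<open>The scalar is normalised for axes with \<open>norm w ^ 2 = 1 + \<gamma>\<^sup>2\<close>, such as \<open>fixed_dir\<close>.\<close>

definition half_turn :: "real \<Rightarrow> real^3 \<Rightarrow> real^3 \<Rightarrow> real^3" where
  "half_turn \<gamma> w v = (2 / (1 + \<gamma>\<^sup>2) * (w \<bullet> v)) *\<^sub>R w - v"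

lemma cos_char_angle: "cos (char_angle \<gamma>) = (1 - \<gamma>\<^sup>2) / (1 + \<gamma>\<^sup>2)"
proof -
  have "1 + \<gamma>\<^sup>2 > 0" by (simp add: add_pos_nonneg)
  then show ?thesis
    unfolding char_angle_def cos_double cos_arctan sin_arctan
    by (simp add: power_divide field_simps)
qed

lemma sin_char_angle: "sin (char_angle \<gamma>) = 2 * \<gamma> / (1 + \<gamma>\<^sup>2)"
proof -
  have "1 + \<gamma>\<^sup>2 > 0" by (simp add: add_pos_nonneg)
  then show ?thesis
    unfolding char_angle_def sin_double cos_arctan sin_arctan
    by (simp add: power_divide field_simps)
qed

text \<open>In the plane of \<open>e1\<close> and \<open>e2\<close> the collision matrix is a
  reflection, and it negates \<open>e3\<close>; hence it is a rotation by pi. Half-angle formulas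
  identify its axis as \<open>e2 - \<gamma> e1\<close>, which is \<open>fixed_dir\<close>. This
  removes frames and angles from the later computations.\<close>

lemma collision_eq:
  assumes "0 < \<rho>" "\<rho> < 1/2" "k \<in> lattice" "(q$1 - k$1)\<^sup>2 + (q$2 - k$2)\<^sup>2 = \<rho>\<^sup>2"
  shows "collision \<rho> \<gamma> q v = half_turn \<gamma> (fixed_dir \<rho> \<gamma> k q) v"
proof -
  define x y where "x = (q$1 - k$1) / \<rho>" and "y = (q$2 - k$2) / \<rho>"
  have e3: "e3 \<rho> q = vector [x, y, 0]"
    using e3_eq[OF assms] by (simp add: x_def y_def)
  have e1: "e1 = vector [0, 0, 1]"
    by (simp add: e1_def vec_eq_iff forall_3 axis_def)
  have e2: "e2 \<rho> q = vector [y, - x, 0]"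
    by (simp add: e2_def e3 e1 cross3_def)
  have w: "fixed_dir \<rho> \<gamma> k q = vector [y, - x, - \<gamma>]"
    by (simp add: fixed_dir_def x_def y_def add: minus_divide_left del: divide_minus_left)
  have xy: "y\<^sup>2 = 1 - x\<^sup>2"
    using assms by (simp add: x_def y_def power_divide field_simps)
  \<comment> \<open>\<open>c\<close> is one plus the cosine of the characteristic angle; both
    trigonometric entries become polynomial in \<open>c\<close> and \<open>\<gamma>\<close>, tied by
    the last relation in \<open>cs\<close>.\<close>
  define c where "c = 2 / (1 + \<gamma>\<^sup>2)"
  have g: "1 + \<gamma>\<^sup>2 > 0" by (simp add: add_pos_nonneg)
  have cs: "cos (char_angle \<gamma>) = c - 1" "sin (char_angle \<gamma>) = c * \<gamma>" "c * \<gamma>\<^sup>2 = 2 - c"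
    using g by (simp_all add: cos_char_angle sin_char_angle c_def field_simps)
  have "collision \<rho> \<gamma> q v $ i = half_turn \<gamma> (fixed_dir \<rho> \<gamma> k q) v $ i" for i
  proof -
    have "collision \<rho> \<gamma> q v $ 1 = half_turn \<gamma> (fixed_dir \<rho> \<gamma> k q) v $ 1"
      "collision \<rho> \<gamma> q v $ 2 = half_turn \<gamma> (fixed_dir \<rho> \<gamma> k q) v $ 2"
      "collision \<rho> \<gamma> q v $ 3 = half_turn \<gamma> (fixed_dir \<rho> \<gamma> k q) v $ 3"
      unfolding collision_def half_turn_def w frame_def e1 e2 e3 collision_matrix_def cs
        c_def[symmetric]
      using xy cs(3)
      by (simp_all add: matrix_vector_mult_def matrix_matrix_mult_def transpose_def sum_3
          inner_vec_def) algebra+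
    then show ?thesis
      using exhaust_3[of i] by auto
  qed
  then show ?thesis
    by (simp add: vec_eq_iff)
qed

section \<open>Hitting the neighbouring scatterer\<close>

lemma between_affine:
  fixes a b l u v s t :: real
  assumes "0 < s" "s < t" "l < a" "a < u" "l < a + t * v" "a + t * v < u"
  shows "l < a + s * v" "a + s * v < u"
proof -
  define r where "r = s / t"
  have r: "0 < r" "0 < 1 - r" and eq: "a + s * v = (1 - r) * a + r * (a + t * v)"
    using assms by (simp_all add: r_def field_simps)
  have "(1 - r) * l < (1 - r) * a" "r * l < r * (a + t * v)"
    "(1 - r) * a < (1 - r) * u" "r * (a + t * v) < r * u"
    using assms r by (simp_all only: mult_strict_left_mono)
  moreover have "(1 - r) * l + r * l = l" "(1 - r) * u + r * u = u"
    by (simp_all add: algebra_simps)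
  ultimately show "l < a + s * v" "a + s * v < u"
    unfolding eq by linarith+
qed

text \<open>The squared distance from the origin is quadratic in \<open>s\<close>, with nonnegative
  leading and positive linear coefficient.\<close>

lemma outside_disc:
  fixes x y :: real
  assumes "0 < s" "x * v + y * w > 0"
  shows "(x + s * v)\<^sup>2 + (y + s * w)\<^sup>2 > x\<^sup>2 + y\<^sup>2"
proof -
  have "(x + s * v)\<^sup>2 + (y + s * w)\<^sup>2 = x\<^sup>2 + y\<^sup>2 + 2 * (s * (x * v + y * w)) + s\<^sup>2 * (v\<^sup>2 + w\<^sup>2)"
    by algebra
  moreover have "s * (x * v + y * w) > 0" using assms by simp
  moreover have "s\<^sup>2 * (v\<^sup>2 + w\<^sup>2) \<ge> 0" by simp
  ultimately show ?thesis by linarith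
qed

lemma circle_coord_le:
  fixes x y r :: real
  assumes "x\<^sup>2 + y\<^sup>2 = r\<^sup>2" "0 < r"
  shows "\<bar>x\<bar> \<le> r" "\<bar>y\<bar> \<le> r"
proof -
  have "x\<^sup>2 \<le> r\<^sup>2" "y\<^sup>2 \<le> r\<^sup>2"
    unfolding assms(1)[symmetric] by simp_all
  then show "\<bar>x\<bar> \<le> r" "\<bar>y\<bar> \<le> r"
    using assms(2) by (simp_all flip: power2_le_iff_abs_le)
qed

text \<open>By convexity the flight stays in the open rectangle \<open>0 < x < 1\<close>,
  \<open>-1/2 < y < 1/2\<close>, which only the circles about (0,0) and (1,0) can meet because
  \<open>\<rho> < 1/2\<close>. Moving outward, the line cannot return to the first circle; followed
  backwards from the hit, it cannot have met the second one earlier.\<close>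

lemma first_hit:
  fixes q v :: "real^3" and t :: real
  defines "q' \<equiv> q + t *\<^sub>R v"
  assumes \<rho>: "0 < \<rho>" "\<rho> < 1/2" and t: "0 < t"
    and q: "(q$1)\<^sup>2 + (q$2)\<^sup>2 = \<rho>\<^sup>2" "q$1 * v$1 + q$2 * v$2 > 0"
    and q': "(q'$1 - 1)\<^sup>2 + (q'$2)\<^sup>2 = \<rho>\<^sup>2" "(q'$1 - 1) * v$1 + q'$2 * v$2 < 0"
    and strip: "0 < q$1" "q$1 < 1" "0 < q'$1" "q'$1 < 1"
      "- (1/2) < q$2" "q$2 < 1/2" "- (1/2) < q'$2" "q'$2 < 1/2"
  shows "t \<in> hit_times \<rho> (q, v)" "Inf (hit_times \<rho> (q, v)) = t"
proof -
  have "vector [1, 0] \<in> lattice"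
    by (simp add: lattice_def forall_2)
  then show mem: "t \<in> hit_times \<rho> (q, v)"
    using t q'(1) by (force simp: hit_times_def bdry_iff'[OF \<rho>] q'_def)
  have lower: "t \<le> s" if s: "s \<in> hit_times \<rho> (q, v)" for s
  proof (rule ccontr)
    assume "\<not> t \<le> s"
    then have st: "0 < s" "s < t" using s by (auto simp: hit_times_def)
    define x y where "x = q$1 + s * v$1" and "y = q$2 + s * v$2"
    obtain k where k: "k \<in> lattice" "(x - k$1)\<^sup>2 + (y - k$2)\<^sup>2 = \<rho>\<^sup>2"
      using s by (auto simp: hit_times_def bdry_iff'[OF \<rho>] x_def y_def)
    have x: "0 < x" "x < 1"
      using between_affine[OF st, of 0 "q$1" 1 "v$1"] strip by (simp_all add: x_def q'_def)
    have y: "- (1/2) < y" "y < 1/2"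
      using between_affine[OF st, of "-(1/2)" "q$2" "1/2" "v$2"] strip
      by (simp_all add: y_def q'_def)
    obtain i j :: int where ij: "k$1 = of_int i" "k$2 = of_int j"
      using k(1) by (auto simp: lattice_def forall_2 elim!: Ints_cases)
    have "\<bar>y - k$2\<bar> \<le> \<rho>" "\<bar>x - k$1\<bar> \<le> \<rho>"
      using circle_coord_le[OF k(2) \<rho>(1)] by simp_all
    then have "-1 < real_of_int j" "real_of_int j < 1" "-1 < real_of_int i" "real_of_int i < 2"
      using x y \<rho> ij by linarith+
    then have "j = 0" "i = 0 \<or> i = 1" by linarith+
    then show False
    proof (elim disjE)
      assume "i = 0" "j = 0"
      then show False
        using outside_disc[OF st(1) q(2)] k(2) q(1) ij by (simp add: x_def y_def)
    next
      assume "i = 1" "j = 0"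
      have "(q'$1 - 1) * (- v$1) + q'$2 * (- v$2) > 0" using q'(2) by simp
      from outside_disc[OF _ this, of "t - s"] st q'(1)
      have "(q'$1 - 1 + (t - s) * (- v$1))\<^sup>2 + (q'$2 + (t - s) * (- v$2))\<^sup>2 > \<rho>\<^sup>2"
        by simp
      moreover have "q'$1 - 1 + (t - s) * (- v$1) = x - k$1" "q'$2 + (t - s) * (- v$2) = y - k$2"
        using \<open>i = 1\<close> \<open>j = 0\<close> ij by (simp_all add: q'_def x_def y_def algebra_simps)
      ultimately show False using k(2) by simp
    qed
  qed
  show "Inf (hit_times \<rho> (q, v)) = t"
    using mem lower by (intro cInf_eq_minimum)
qed

section \<open>The reflection symmetry\<close>

text \<open>A mirror image also reverses the sense of rotation. Changing both signs gives a half
  turn of three-space, which preserves orientation and so is compatible with the product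
  frames.\<close>

definition flip :: "real^3 \<Rightarrow> real^3" where
  "flip x = vector [- x$1, x$2, - x$3]"

text \<open>The free constant \<open>c\<close> will be the rotation accumulated in one flight, so
  that reflecting the landing point gives back the starting point.\<close>

definition reflect :: "real \<Rightarrow> real^3 \<Rightarrow> real^3" where
  "reflect c q = flip q + vector [1, 0, c]"

definition reflect_state :: "real \<Rightarrow> state \<Rightarrow> state" where
  "reflect_state c = (\<lambda>(q, v). (reflect c q, flip v))"

lemma flip_simps [simp]: "flip x $ 1 = - x$1" "flip x $ 2 = x$2" "flip x $ 3 = - x$3"
  by (simp_all add: flip_def)

lemma reflect_simps [simp]:
  "reflect c q $ 1 = 1 - q$1" "reflect c q $ 2 = q$2" "reflect c q $ 3 = c - q$3"
  by (simp_all add: reflect_def)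

lemma reflect_reflect [simp]: "reflect c (reflect c q) = q"
  and flip_flip [simp]: "flip (flip v) = v"
  by (simp_all add: vec_eq_iff forall_3)

lemma reflect_state_reflect_state [simp]: "reflect_state c (reflect_state c \<eta>) = \<eta>"
  by (simp add: reflect_state_def split: prod.split)

lemma reflect_line: "reflect c q + s *\<^sub>R flip v = reflect c (q + s *\<^sub>R v)"
  by (simp add: vec_eq_iff forall_3 algebra_simps)

lemma norm_flip [simp]: "norm (flip v) = norm v"
  by (simp add: norm_vec_def L2_set_def sum_3)

text \<open>A half turn depends on its axis only up to sign. The minus sign is there because the
  \<open>fixed_dir\<close> of the mirrored circle is \<open>- flip\<close> of the original
  one.\<close>

lemma flip_half_turn: "flip (half_turn \<gamma> w v) = half_turn \<gamma> (- flip w) (flip v)"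
proof -
  have "(- flip w) \<bullet> flip v = - (w \<bullet> v)"
    by (simp add: inner_vec_def sum_3)
  then show ?thesis
    by (simp add: half_turn_def vec_eq_iff forall_3)
qed

definition mirror_centre :: "real^2 \<Rightarrow> real^2" where
  "mirror_centre k = vector [1 - k$1, k$2]"

lemma mirror_centre_simps [simp]: "mirror_centre k $ 1 = 1 - k$1" "mirror_centre k $ 2 = k$2"
  by (simp_all add: mirror_centre_def)

lemma mirror_centre_lattice: "k \<in> lattice \<Longrightarrow> mirror_centre k \<in> lattice"
  by (simp add: lattice_def forall_2)

lemma reflect_on_circle:
  assumes "(q$1 - k$1)\<^sup>2 + (q$2 - k$2)\<^sup>2 = r"
  shows "(reflect c q $ 1 - mirror_centre k $ 1)\<^sup>2 + (reflect c q $ 2 - mirror_centre k $ 2)\<^sup>2 = r"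
  using assms by (simp add: power2_commute)

lemma bdry_reflect:
  assumes "0 < \<rho>" "\<rho> < 1/2"
  shows "reflect c q \<in> bdry \<rho> \<longleftrightarrow> q \<in> bdry \<rho>"
proof -
  have "reflect c q \<in> bdry \<rho>" if "q \<in> bdry \<rho>" for q
    using that mirror_centre_lattice reflect_on_circle unfolding bdry_iff'[OF assms] by blast
  from this[of q] this[of "reflect c q"] show ?thesis by auto
qed

lemma hit_times_reflect:
  assumes "0 < \<rho>" "\<rho> < 1/2"
  shows "hit_times \<rho> (reflect_state c \<eta>) = hit_times \<rho> \<eta>"
  by (cases \<eta>) (simp add: hit_times_def reflect_state_def reflect_line bdry_reflect[OF assms])

lemma phase_space_reflect:
  assumes "0 < \<rho>" "\<rho> < 1/2" "\<eta> \<in> phase_space \<rho>"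
  shows "reflect_state c \<eta> \<in> phase_space \<rho>"
proof -
  obtain q v where \<eta>: "\<eta> = (q, v)" by fastforce
  obtain k where k: "k \<in> lattice" "(q$1 - k$1)\<^sup>2 + (q$2 - k$2)\<^sup>2 = \<rho>\<^sup>2"
      "(q$1 - k$1) * v$1 + (q$2 - k$2) * v$2 > 0" and v: "norm v = 1"
    using assms(3) unfolding \<eta> phase_space_iff[OF assms(1,2)] by auto
  have "(reflect c q $ 1 - mirror_centre k $ 1) * flip v $ 1 +
      (reflect c q $ 2 - mirror_centre k $ 2) * flip v $ 2 > 0"
    using k(3) by (simp add: algebra_simps)
  then have "(reflect c q, flip v) \<in> phase_space \<rho>"
    unfolding phase_space_iff[OF assms(1,2)]
    using v mirror_centre_lattice[OF k(1)] reflect_on_circle[OF k(2), of c] norm_flip[of v]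
    by (metis (no_types))
  then show ?thesis by (simp add: \<eta> reflect_state_def)
qed

lemma collision_reflect:
  assumes "0 < \<rho>" "\<rho> < 1/2" "q \<in> bdry \<rho>"
  shows "collision \<rho> \<gamma> (reflect c q) (flip v) = flip (collision \<rho> \<gamma> q v)"
proof -
  obtain k where k: "k \<in> lattice" "(q$1 - k$1)\<^sup>2 + (q$2 - k$2)\<^sup>2 = \<rho>\<^sup>2"
    using assms(3) by (auto simp: bdry_iff'[OF assms(1,2)])
  have "fixed_dir \<rho> \<gamma> (mirror_centre k) (reflect c q) = - flip (fixed_dir \<rho> \<gamma> k q)"
    by (simp add: fixed_dir_def vec_eq_iff forall_3 add: minus_divide_left del: divide_minus_left)
  then show ?thesis
    using collision_eq[OF assms(1,2) mirror_centre_lattice[OF k(1)] reflect_on_circle[OF k(2)]]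
      collision_eq[OF assms(1,2) k]
    by (simp add: flip_half_turn)
qed

text \<open>Hitting times are invariant under the reflection and collisions commute with it; the
  hypothesis provides a circle through the landing point, where the collision law is known.\<close>

lemma billiard_map_reflect:
  assumes "0 < \<rho>" "\<rho> < 1/2" "fst (billiard_map \<rho> \<gamma> \<eta>) \<in> bdry \<rho>"
  shows "billiard_map \<rho> \<gamma> (reflect_state c \<eta>) = reflect_state c (billiard_map \<rho> \<gamma> \<eta>)"
proof -
  obtain q v where \<eta>: "\<eta> = (q, v)" by fastforce
  have "hit_times \<rho> (reflect c q, flip v) = hit_times \<rho> (q, v)"
    using hit_times_reflect[OF assms(1,2), of c "(q, v)"] by (simp add: reflect_state_def)
  then show ?thesis
    using assms(3)
    by (simp add: \<eta> billiard_map_def reflect_state_def Let_def reflect_line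
        collision_reflect[OF assms(1,2)])
qed

section \<open>The billiard map near the orbit\<close>

text \<open>\<open>flight\<close> is the smaller root of the quadratic equation for the times at which the line through
  \<open>\<eta>\<close> meets the circle of radius \<open>\<rho>\<close> about \<open>(1, 0)\<close>; it makes the reflected billiard map
  \<open>return_map\<close> an explicit smooth map on an open subset of \<open>\<real>\<^sup>6\<close>, not only on the phase space.\<close>

definition approach :: "state \<Rightarrow> real" where
  "approach \<eta> = (fst \<eta> $ 1 - 1) * snd \<eta> $ 1 + fst \<eta> $ 2 * snd \<eta> $ 2"

definition speed2 :: "state \<Rightarrow> real" where
  "speed2 \<eta> = (snd \<eta> $ 1)\<^sup>2 + (snd \<eta> $ 2)\<^sup>2"

definition discr :: "real \<Rightarrow> state \<Rightarrow> real" where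
  "discr \<rho> \<eta> = (approach \<eta>)\<^sup>2 - speed2 \<eta> * ((fst \<eta> $ 1 - 1)\<^sup>2 + (fst \<eta> $ 2)\<^sup>2 - \<rho>\<^sup>2)"

definition flight :: "real \<Rightarrow> state \<Rightarrow> real" where
  "flight \<rho> \<eta> = (- approach \<eta> - sqrt (discr \<rho> \<eta>)) / speed2 \<eta>"

definition landing :: "real \<Rightarrow> real \<Rightarrow> state \<Rightarrow> real^3" where
  "landing \<rho> c \<eta> = reflect c (fst \<eta> + flight \<rho> \<eta> *\<^sub>R snd \<eta>)"

text \<open>Reflecting before colliding moves the collision to the circle about the origin, hence
  the centre 0 in \<open>fixed_dir\<close>; by symmetry this is the mirror image of the true
  collision at the circle about (1,0).\<close>

definition return_map :: "real \<Rightarrow> real \<Rightarrow> real \<Rightarrow> state \<Rightarrow> state" where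
  "return_map \<rho> \<gamma> c \<eta> =
     (landing \<rho> c \<eta>, half_turn \<gamma> (fixed_dir \<rho> \<gamma> 0 (landing \<rho> c \<eta>)) (flip (snd \<eta>)))"

text \<open>At the smaller root, half the slope of the quadratic is
  \<open>- sqrt (discr \<rho> \<eta>)\<close>. For positive discriminant the second identity
  therefore says that the circle is entered from outside and transversally.\<close>

lemma flight_hits:
  assumes "speed2 \<eta> > 0" "discr \<rho> \<eta> \<ge> 0"
  defines "q' \<equiv> fst \<eta> + flight \<rho> \<eta> *\<^sub>R snd \<eta>"
  shows "(q'$1 - 1)\<^sup>2 + (q'$2)\<^sup>2 = \<rho>\<^sup>2"
    and "(q'$1 - 1) * snd \<eta> $ 1 + q'$2 * snd \<eta> $ 2 = - sqrt (discr \<rho> \<eta>)"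
proof -
  define x y u w t where "x = fst \<eta> $ 1 - 1" and "y = fst \<eta> $ 2"
    and "u = snd \<eta> $ 1" and "w = snd \<eta> $ 2" and "t = flight \<rho> \<eta>"
  have q': "q'$1 - 1 = x + t * u" "q'$2 = y + t * w"
    by (simp_all add: q'_def x_def y_def u_def w_def t_def)
  have sp: "speed2 \<eta> = u\<^sup>2 + w\<^sup>2" and ap: "approach \<eta> = x * u + y * w"
    by (simp_all add: speed2_def approach_def x_def y_def u_def w_def)
  have 1: "approach \<eta> + t * speed2 \<eta> = - sqrt (discr \<rho> \<eta>)"
    using assms(1) by (simp add: t_def flight_def)
  then show "(q'$1 - 1) * snd \<eta> $ 1 + q'$2 * snd \<eta> $ 2 = - sqrt (discr \<rho> \<eta>)"
    unfolding q' sp ap u_def[symmetric] w_def[symmetric] by (simp add: algebra_simps power2_eq_square)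
  have "(approach \<eta> + t * speed2 \<eta>)\<^sup>2 = discr \<rho> \<eta>"
    unfolding 1 using assms(2) by simp
  moreover have "discr \<rho> \<eta> = (approach \<eta>)\<^sup>2 - speed2 \<eta> * (x\<^sup>2 + y\<^sup>2 - \<rho>\<^sup>2)"
    by (simp add: discr_def x_def y_def)
  \<comment> \<open>Completing the square: multiplied by its leading coefficient, the quadratic is a
    difference that vanishes at \<open>t\<close>.\<close>
  moreover have "speed2 \<eta> * (x\<^sup>2 + y\<^sup>2 - \<rho>\<^sup>2 + 2 * t * approach \<eta> + t\<^sup>2 * speed2 \<eta>) =
      (approach \<eta> + t * speed2 \<eta>)\<^sup>2 - ((approach \<eta>)\<^sup>2 - speed2 \<eta> * (x\<^sup>2 + y\<^sup>2 - \<rho>\<^sup>2))"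
    by (simp add: power2_eq_square algebra_simps)
  ultimately have "speed2 \<eta> * (x\<^sup>2 + y\<^sup>2 - \<rho>\<^sup>2 + 2 * t * approach \<eta> + t\<^sup>2 * speed2 \<eta>) = 0"
    by simp
  then have "x\<^sup>2 + y\<^sup>2 - \<rho>\<^sup>2 + 2 * t * approach \<eta> + t\<^sup>2 * speed2 \<eta> = 0"
    using assms(1) by simp
  then show "(q'$1 - 1)\<^sup>2 + (q'$2)\<^sup>2 = \<rho>\<^sup>2"
    unfolding q' sp ap by algebra
qed

text \<open>All conditions are strict, so they persist nearby. The bound \<open>1/2\<close> on the
  first coordinate forces a phase point to leave the scatterer at the origin, and the remaining
  bounds supply the rectangle for \<open>first_hit\<close>.\<close>

definition regular :: "real \<Rightarrow> real \<Rightarrow> state \<Rightarrow> bool" where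
  "regular \<rho> c \<eta> \<longleftrightarrow> speed2 \<eta> > 0 \<and> discr \<rho> \<eta> > 0 \<and> flight \<rho> \<eta> > 0 \<and>
     0 < fst \<eta> $ 1 \<and> fst \<eta> $ 1 < 1/2 \<and> - (1/2) < fst \<eta> $ 2 \<and> fst \<eta> $ 2 < 1/2 \<and>
     0 < landing \<rho> c \<eta> $ 1 \<and> landing \<rho> c \<eta> $ 1 < 1 \<and>
     - (1/2) < landing \<rho> c \<eta> $ 2 \<and> landing \<rho> c \<eta> $ 2 < 1/2"

lemma norm_half_turn:
  assumes "w \<bullet> w = 1 + \<gamma>\<^sup>2"
  shows "norm (half_turn \<gamma> w v) = norm v"
proof -
  define c where "c = 2 / (1 + \<gamma>\<^sup>2)"
  have "1 + \<gamma>\<^sup>2 > 0" by (simp add: add_pos_nonneg)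
  then have c: "c * (w \<bullet> w) = 2" unfolding c_def assms by (metis nonzero_eq_divide_eq less_irrefl)
  have "half_turn \<gamma> w v \<bullet> half_turn \<gamma> w v =
      c * (w \<bullet> v)\<^sup>2 * (c * (w \<bullet> w)) - 2 * c * (w \<bullet> v)\<^sup>2 + v \<bullet> v"
    unfolding half_turn_def c_def[symmetric]
    by (simp add: inner_diff_left inner_diff_right inner_commute power2_eq_square algebra_simps)
  then have "half_turn \<gamma> w v \<bullet> half_turn \<gamma> w v = v \<bullet> v"
    by (simp add: c)
  then show ?thesis by (simp add: norm_eq_sqrt_inner)
qed

lemma regular_phase_space:
  assumes \<rho>: "0 < \<rho>" "\<rho> < 1/2" and reg: "regular \<rho> c \<eta>" and ph: "\<eta> \<in> phase_space \<rho>"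
  shows "hit_times \<rho> \<eta> \<noteq> {}"
    and "billiard_map \<rho> \<gamma> \<eta> = reflect_state c (return_map \<rho> \<gamma> c \<eta>)"
    and "return_map \<rho> \<gamma> c \<eta> \<in> phase_space \<rho>"
    and "billiard_map \<rho> \<gamma> \<eta> \<in> phase_space \<rho>"
proof -
  obtain q v where \<eta>: "\<eta> = (q, v)" by fastforce
  obtain k where k: "k \<in> lattice" "(q$1 - k$1)\<^sup>2 + (q$2 - k$2)\<^sup>2 = \<rho>\<^sup>2"
      "(q$1 - k$1) * v$1 + (q$2 - k$2) * v$2 > 0" and v: "norm v = 1"
    using ph unfolding \<eta> phase_space_iff[OF \<rho>] by auto
  obtain i j :: int where ij: "k$1 = of_int i" "k$2 = of_int j"
    using k(1) by (auto simp: lattice_def forall_2 elim!: Ints_cases)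
  have "\<bar>q$2 - k$2\<bar> \<le> \<rho>" "\<bar>q$1 - k$1\<bar> \<le> \<rho>"
    using circle_coord_le[OF k(2) \<rho>(1)] by simp_all
  then have "-1 < real_of_int j" "real_of_int j < 1" "-1 < real_of_int i" "real_of_int i < 1"
    using reg \<rho> ij unfolding regular_def \<eta> fst_conv by linarith+
  then have k0: "k = 0" using ij by (simp add: vec_eq_iff forall_2)
  define t where "t = flight \<rho> \<eta>"
  define q' where "q' = q + t *\<^sub>R v"
  have l: "landing \<rho> c \<eta> = reflect c q'"
    by (simp add: landing_def q'_def t_def \<eta>)
  have circ: "(q'$1 - 1)\<^sup>2 + (q'$2)\<^sup>2 = \<rho>\<^sup>2"
    using flight_hits(1)[of \<eta> \<rho>] reg by (simp add: regular_def q'_def t_def \<eta>)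
  have inc: "(q'$1 - 1) * v$1 + q'$2 * v$2 < 0"
    using flight_hits(2)[of \<eta> \<rho>] reg by (simp add: regular_def q'_def t_def \<eta>)
  have strip: "0 < t" "0 < q$1" "q$1 < 1" "- (1/2) < q$2" "q$2 < 1/2"
    "0 < q'$1" "q'$1 < 1" "- (1/2) < q'$2" "q'$2 < 1/2"
    using reg unfolding regular_def l t_def by (simp_all add: \<eta>)
  have fh: "t \<in> hit_times \<rho> (q, v)" "Inf (hit_times \<rho> (q, v)) = t"
    using first_hit[OF \<rho>, of t q v, folded q'_def] strip k(2,3) circ inc
    by (simp_all add: k0)
  then show "hit_times \<rho> \<eta> \<noteq> {}" by (auto simp: \<eta>)
  have e: "vector [1, 0] \<in> lattice"
    by (simp add: lattice_def forall_2)
  have coll: "collision \<rho> \<gamma> q' v = half_turn \<gamma> (fixed_dir \<rho> \<gamma> (vector [1, 0]) q') v"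
    using circ by (intro collision_eq[OF \<rho> e]) simp
  have w: "- flip (fixed_dir \<rho> \<gamma> 0 (reflect c q')) = fixed_dir \<rho> \<gamma> (vector [1, 0]) q'"
    by (simp add: fixed_dir_def vec_eq_iff forall_3 minus_divide_left del: divide_minus_left)
  show bm: "billiard_map \<rho> \<gamma> \<eta> = reflect_state c (return_map \<rho> \<gamma> c \<eta>)"
    by (simp add: billiard_map_def \<eta> fh Let_def reflect_state_def return_map_def flip_half_turn
        l[unfolded \<eta>] coll w flip: q'_def)
  define p where "p = reflect c q'"
  define W where "W = fixed_dir \<rho> \<gamma> 0 p"
  have pc: "(p$1)\<^sup>2 + (p$2)\<^sup>2 = \<rho>\<^sup>2"
    using circ by (simp add: p_def power2_commute)
  have "W \<bullet> W = ((p$1)\<^sup>2 + (p$2)\<^sup>2) / \<rho>\<^sup>2 + \<gamma>\<^sup>2"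
    by (simp add: W_def fixed_dir_def inner_vec_def sum_3 power2_eq_square add_divide_distrib)
  then have nrm: "norm (half_turn \<gamma> W (flip v)) = norm (flip v)"
    using \<rho> by (intro norm_half_turn) (simp add: pc)
  have "W$1 = p$2 / \<rho>" "W$2 = - (p$1 / \<rho>)"
    by (simp_all add: W_def fixed_dir_def)
  \<comment> \<open>The axis \<open>W\<close> is orthogonal to the radial direction at
    \<open>p\<close>, so the half turn negates the normal component: incoming becomes
    outgoing.\<close>
  then have "p$1 * half_turn \<gamma> W (flip v) $ 1 + p$2 * half_turn \<gamma> W (flip v) $ 2 =
      - ((q'$1 - 1) * v$1 + q'$2 * v$2)"
    by (simp add: half_turn_def) (simp add: p_def algebra_simps)
  then have "(p, half_turn \<gamma> W (flip v)) \<in> phase_space \<rho>"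
    unfolding phase_space_iff[OF \<rho>] using v inc pc nrm
    by (auto simp: lattice_def intro!: exI[of _ 0] bexI[of _ 0])
  then show "return_map \<rho> \<gamma> c \<eta> \<in> phase_space \<rho>"
    by (simp add: return_map_def l W_def p_def) (simp add: \<eta>)
  then show "billiard_map \<rho> \<gamma> \<eta> \<in> phase_space \<rho>"
    unfolding bm by (rule phase_space_reflect[OF \<rho>])
qed

text \<open>Write T for the billiard map, S for the reflection and F for the return map. Then T = S
  F on regular phase points, T commutes with S, and S is an involution, so T S F = S T F = S S F F =
  F F.\<close>

lemma regular_billiard_map_twice:
  assumes \<rho>: "0 < \<rho>" "\<rho> < 1/2"
    and reg: "regular \<rho> c \<eta>" "\<eta> \<in> phase_space \<rho>" "regular \<rho> c (return_map \<rho> \<gamma> c \<eta>)"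
  shows "billiard_map \<rho> \<gamma> (billiard_map \<rho> \<gamma> \<eta>) = return_map \<rho> \<gamma> c (return_map \<rho> \<gamma> c \<eta>)"
proof -
  let ?\<zeta> = "return_map \<rho> \<gamma> c \<eta>"
  note r = regular_phase_space[OF \<rho> reg(1,2)]
  note r' = regular_phase_space[OF \<rho> reg(3) r(3)]
  have "fst (billiard_map \<rho> \<gamma> ?\<zeta>) \<in> bdry \<rho>"
    using r'(4)[of \<gamma>] by (auto simp: phase_space_def)
  then show ?thesis
    by (simp add: r(2) billiard_map_reflect[OF \<rho>] r'(2))
qed

section \<open>Derivative of the return map\<close>

lemma bounded_linear_flip: "bounded_linear flip"
  by (intro bounded_linear_intro[of _ 1]) (simp_all add: vec_eq_iff forall_3)

definition spin :: "real \<Rightarrow> real^3 \<Rightarrow> real^3" where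
  "spin \<rho> x = vector [x$2 / \<rho>, - (x$1 / \<rho>), 0]"

lemma bounded_linear_spin: "bounded_linear (spin \<rho>)"
proof -
  have "linear (spin \<rho>)"
    by (rule linearI) (simp_all add: spin_def vec_eq_iff forall_3 add_divide_distrib)
  then show ?thesis by (simp add: linear_conv_bounded_linear)
qed

text \<open>The square root and the quotient are smooth where \<open>discr\<close> and
  \<open>speed2\<close> are positive. The derivative is left schematic and assembled by the
  rules.\<close>

lemma flight_has_derivative:
  assumes "speed2 \<eta> > 0" "discr \<rho> \<eta> > 0"
  shows "\<exists>\<tau>. (flight \<rho> has_derivative \<tau>) (at \<eta>)"
proof -
  have nth: "((\<lambda>\<eta>. fst \<eta> $ i) has_derivative (\<lambda>\<delta>. fst \<delta> $ i)) (at \<eta>)"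
    "((\<lambda>\<eta>. snd \<eta> $ i) has_derivative (\<lambda>\<delta>. snd \<delta> $ i)) (at \<eta>)" for i :: 3 and \<eta> :: state
    by (auto intro!: derivative_eq_intros bounded_linear.has_derivative[OF bounded_linear_vec_nth])
  have ap: "\<exists>\<tau>. (approach has_derivative \<tau>) (at \<eta>)"
    unfolding approach_def[abs_def] by (rule exI) (rule derivative_intros nth)+
  have sp: "\<exists>\<tau>. (speed2 has_derivative \<tau>) (at \<eta>)"
    unfolding speed2_def[abs_def] by (rule exI) (rule derivative_intros nth)+
  obtain \<tau>1 \<tau>2 where \<tau>: "(approach has_derivative \<tau>1) (at \<eta>)" "(speed2 has_derivative \<tau>2) (at \<eta>)"
    using ap sp by blast
  have di: "\<exists>\<tau>. (discr \<rho> has_derivative \<tau>) (at \<eta>)"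
    unfolding discr_def[abs_def] by (rule exI) (rule derivative_intros nth \<tau>)+
  then obtain \<tau>3 where "(discr \<rho> has_derivative \<tau>3) (at \<eta>)"
    by blast
  note \<tau> = \<tau> this
  show ?thesis
    unfolding flight_def[abs_def]
    by (rule exI) (rule derivative_intros \<tau> | use assms in simp)+
qed

lemma landing_on_circle:
  assumes "speed2 \<eta> > 0" "discr \<rho> \<eta> \<ge> 0"
  shows "(landing \<rho> c \<eta> $ 1)\<^sup>2 + (landing \<rho> c \<eta> $ 2)\<^sup>2 = \<rho>\<^sup>2"
  using flight_hits(1)[OF assms] by (simp add: landing_def power2_commute)

lemma fixed_dir_affine: "fixed_dir \<rho> \<gamma> 0 q = spin \<rho> q + vector [0, 0, - \<gamma>]"
  by (simp add: fixed_dir_def spin_def vec_eq_iff forall_3)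

text \<open>The derivative \<open>\<tau>\<close> of the flight time need not be computed: it is determined by the last
  conclusion of \<open>return_map_has_derivative\<close>, the tangency of the landing point to the circle.\<close>

definition landing_deriv :: "real \<Rightarrow> state \<Rightarrow> (state \<Rightarrow> real) \<Rightarrow> state \<Rightarrow> real^3" where
  "landing_deriv \<rho> \<eta> \<tau> \<delta> = flip (fst \<delta> + flight \<rho> \<eta> *\<^sub>R snd \<delta> + \<tau> \<delta> *\<^sub>R snd \<eta>)"

definition return_deriv :: "real \<Rightarrow> real \<Rightarrow> real \<Rightarrow> state \<Rightarrow> (state \<Rightarrow> real) \<Rightarrow> state \<Rightarrow> state" where
  "return_deriv \<rho> \<gamma> c \<eta> \<tau> \<delta> =
     (let Y = landing_deriv \<rho> \<eta> \<tau> \<delta>;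
          W = fixed_dir \<rho> \<gamma> 0 (landing \<rho> c \<eta>) in
      (Y, (2 / (1 + \<gamma>\<^sup>2) * (W \<bullet> flip (snd \<delta>) + spin \<rho> Y \<bullet> flip (snd \<eta>))) *\<^sub>R W +
          (2 / (1 + \<gamma>\<^sup>2) * (W \<bullet> flip (snd \<eta>))) *\<^sub>R spin \<rho> Y - flip (snd \<delta>)))"

lemma return_map_has_derivative:
  assumes sd: "speed2 \<eta> > 0" "discr \<rho> \<eta> > 0"
  obtains \<tau> where
    "(flight \<rho> has_derivative \<tau>) (at \<eta>)"
    "(landing \<rho> c has_derivative landing_deriv \<rho> \<eta> \<tau>) (at \<eta>)"
    "(return_map \<rho> \<gamma> c has_derivative return_deriv \<rho> \<gamma> c \<eta> \<tau>) (at \<eta>)"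
    "\<And>\<delta>. landing \<rho> c \<eta> $ 1 * landing_deriv \<rho> \<eta> \<tau> \<delta> $ 1 +
       landing \<rho> c \<eta> $ 2 * landing_deriv \<rho> \<eta> \<tau> \<delta> $ 2 = 0"
proof -
  obtain \<tau> where \<tau>: "(flight \<rho> has_derivative \<tau>) (at \<eta>)"
    using flight_has_derivative[OF sd] by blast
  note flipd = bounded_linear.has_derivative[OF bounded_linear_flip]
  note spind = bounded_linear.has_derivative[OF bounded_linear_spin]
  note nthd = bounded_linear.has_derivative[OF bounded_linear_vec_nth]
  define Y where "Y = landing_deriv \<rho> \<eta> \<tau>"
  have l: "(landing \<rho> c has_derivative Y) (at \<eta>)"
    unfolding landing_def[abs_def] reflect_def Y_def landing_deriv_def[abs_def]
    by (auto intro!: derivative_eq_intros flipd \<tau> simp: algebra_simps)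
  let ?W = "\<lambda>\<eta>. fixed_dir \<rho> \<gamma> 0 (landing \<rho> c \<eta>)"
  have w: "(?W has_derivative (\<lambda>\<delta>. spin \<rho> (Y \<delta>))) (at \<eta>)"
    unfolding fixed_dir_affine by (auto intro!: derivative_eq_intros spind l)
  have f: "((\<lambda>\<eta>. flip (snd \<eta>)) has_derivative (\<lambda>\<delta>. flip (snd \<delta>))) (at \<eta>)"
    by (auto intro!: derivative_eq_intros flipd)
  have r: "(return_map \<rho> \<gamma> c has_derivative return_deriv \<rho> \<gamma> c \<eta> \<tau>) (at \<eta>)"
    unfolding return_map_def[abs_def] half_turn_def
    by (rule has_derivative_eq_rhs, (rule derivative_intros l w f)+) (simp add: fun_eq_iff return_deriv_def Let_def Y_def)
  \<comment> \<open>Landing points stay on the circle of radius \<open>\<rho>\<close>, so this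
    function is locally constant; uniqueness of derivatives makes its chain-rule derivative
    zero.\<close>
  have "((\<lambda>\<eta>. (landing \<rho> c \<eta> $ 1)\<^sup>2 + (landing \<rho> c \<eta> $ 2)\<^sup>2) has_derivative
      (\<lambda>\<delta>. 2 * (landing \<rho> c \<eta> $ 1 * Y \<delta> $ 1 + landing \<rho> c \<eta> $ 2 * Y \<delta> $ 2))) (at \<eta>)"
    by (auto intro!: derivative_eq_intros nthd l simp: algebra_simps)
  moreover have "((\<lambda>\<eta>. (landing \<rho> c \<eta> $ 1)\<^sup>2 + (landing \<rho> c \<eta> $ 2)\<^sup>2) has_derivative (\<lambda>_. 0)) (at \<eta>)"
  proof (rule has_derivative_transform_eventually)
    show "((\<lambda>_. \<rho>\<^sup>2) has_derivative (\<lambda>_. 0)) (at \<eta>)" by simp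
    have "continuous (at \<eta>) speed2" "continuous (at \<eta>) (discr \<rho>)"
      unfolding speed2_def[abs_def] discr_def[abs_def] approach_def[abs_def]
      by (intro continuous_intros)+
    then have "eventually (\<lambda>\<eta>. speed2 \<eta> > 0) (at \<eta>)" "eventually (\<lambda>\<eta>. discr \<rho> \<eta> > 0) (at \<eta>)"
      using sd by (auto simp: continuous_at intro: order_tendstoD)
    then show "\<forall>\<^sub>F x in at \<eta>. \<rho>\<^sup>2 = (landing \<rho> c x $ 1)\<^sup>2 + (landing \<rho> c x $ 2)\<^sup>2"
      by eventually_elim (simp add: landing_on_circle)
  qed (use sd in \<open>auto simp: landing_on_circle\<close>)
  ultimately have "(\<lambda>\<delta>. 2 * (landing \<rho> c \<eta> $ 1 * Y \<delta> $ 1 + landing \<rho> c \<eta> $ 2 * Y \<delta> $ 2)) = (\<lambda>_. 0)"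
    by (rule has_derivative_unique)
  then have "landing \<rho> c \<eta> $ 1 * Y \<delta> $ 1 + landing \<rho> c \<eta> $ 2 * Y \<delta> $ 2 = 0" for \<delta>
    using fun_cong[of _ _ \<delta>] by fastforce
  then show ?thesis
    using that[OF \<tau> l[unfolded Y_def] r] unfolding Y_def by blast
qed

section \<open>From the return map to the billiard map\<close>

lemma eventually_regular:
  assumes reg: "regular \<rho> c \<eta>"
  shows "eventually (regular \<rho> c) (nhds \<eta>)"
proof -
  have sd: "speed2 \<eta> > 0" "discr \<rho> \<eta> > 0"
    using reg by (simp_all add: regular_def)
  obtain \<tau> Y where "(flight \<rho> has_derivative \<tau>) (at \<eta>)" "(landing \<rho> c has_derivative Y) (at \<eta>)"
    using return_map_has_derivative[OF sd, where c = c] by metis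
  then have c: "isCont (flight \<rho>) \<eta>" "isCont (landing \<rho> c) \<eta>"
    by (auto dest: has_derivative_continuous)
  have "isCont speed2 \<eta>" "isCont (discr \<rho>) \<eta>"
    unfolding speed2_def[abs_def] discr_def[abs_def] approach_def[abs_def]
    by (intro continuous_intros)+
  note tnd = this[unfolded continuous_at tendsto_at_iff_tendsto_nhds]
    c[unfolded continuous_at tendsto_at_iff_tendsto_nhds]
  have id: "((\<lambda>\<eta>. \<eta>) \<longlongrightarrow> \<eta>) (nhds \<eta>)"
    by (rule filterlim_ident)
  note tnds = tnd(1-3) tendsto_vec_nth[OF tnd(4)] tendsto_vec_nth[OF tendsto_fst[OF id]]
  show ?thesis
    unfolding regular_def[abs_def]
    by (intro eventually_conj order_tendstoD[OF tnds(1)] order_tendstoD[OF tnds(2)]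
        order_tendstoD[OF tnds(3)] order_tendstoD[OF tnds(4)] order_tendstoD[OF tnds(5)])
      (use reg in \<open>simp_all add: regular_def\<close>)
qed

text \<open>The return map is continuous at its fixed point, so both a nearby state and its image
  are regular. On the phase space the two second iterates then agree, and the full derivative
  restricts to the derivative within it.\<close>

lemma billiard_map_twice_has_derivative:
  assumes \<rho>: "0 < \<rho>" "\<rho> < 1/2"
    and reg: "regular \<rho> c \<xi>" and ph: "\<xi> \<in> phase_space \<rho>" and fx: "return_map \<rho> \<gamma> c \<xi> = \<xi>"
    and D: "(return_map \<rho> \<gamma> c has_derivative D) (at \<xi>)"
  shows "((\<lambda>\<eta>. billiard_map \<rho> \<gamma> (billiard_map \<rho> \<gamma> \<eta>)) has_derivative (D \<circ> D))
    (at \<xi> within phase_space \<rho>)"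
proof -
  let ?F = "return_map \<rho> \<gamma> c"
  have "((?F \<circ> ?F) has_derivative (D \<circ> D)) (at \<xi>)"
    using D fx by (intro diff_chain_at) simp_all
  then have FF: "((\<lambda>\<eta>. ?F (?F \<eta>)) has_derivative (D \<circ> D)) (at \<xi> within phase_space \<rho>)"
    by (simp add: comp_def has_derivative_at_withinI)
  have "(?F \<longlongrightarrow> ?F \<xi>) (nhds \<xi>)"
    using has_derivative_continuous[OF D]
    unfolding continuous_at tendsto_at_iff_tendsto_nhds .
  then have "(?F \<longlongrightarrow> \<xi>) (nhds \<xi>)"
    unfolding fx .
  then have "eventually (\<lambda>\<eta>. regular \<rho> c (?F \<eta>)) (nhds \<xi>)"
    using eventually_regular[OF reg] by (simp add: filterlim_iff)
  with eventually_regular[OF reg] have "eventually (\<lambda>\<eta>. regular \<rho> c \<eta> \<and> regular \<rho> c (?F \<eta>)) (nhds \<xi>)"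
    by eventually_elim simp
  then have ev: "eventually (\<lambda>\<eta>. regular \<rho> c \<eta> \<and> regular \<rho> c (?F \<eta>) \<and> \<eta> \<in> phase_space \<rho>)
      (at \<xi> within phase_space \<rho>)"
    by (auto simp: eventually_at_filter elim: eventually_mono)
  show ?thesis
    using FF
  proof (rule has_derivative_transform_eventually)
    show "\<forall>\<^sub>F \<eta> in at \<xi> within phase_space \<rho>. ?F (?F \<eta>) = billiard_map \<rho> \<gamma> (billiard_map \<rho> \<gamma> \<eta>)"
      using ev by eventually_elim (metis regular_billiard_map_twice[OF \<rho>])
    show "?F (?F \<xi>) = billiard_map \<rho> \<gamma> (billiard_map \<rho> \<gamma> \<xi>)"
      using regular_billiard_map_twice[OF \<rho> reg ph] reg fx by simp
    show "\<xi> \<in> phase_space \<rho>" by (rule ph)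
  qed
qed

lemma regular_fixed_point_period_2:
  assumes \<rho>: "0 < \<rho>" "\<rho> < 1/2"
    and reg: "regular \<rho> c \<xi>" and ph: "\<xi> \<in> phase_space \<rho>" and fx: "return_map \<rho> \<gamma> c \<xi> = \<xi>"
  shows "period_2 \<rho> \<gamma> \<xi>"
proof -
  have T: "billiard_map \<rho> \<gamma> \<xi> = reflect_state c \<xi>"
    using regular_phase_space(2)[OF \<rho> reg ph, of \<gamma>] fx by simp
  have TT: "billiard_map \<rho> \<gamma> (billiard_map \<rho> \<gamma> \<xi>) = \<xi>"
    using regular_billiard_map_twice[OF \<rho> reg ph, of \<gamma>] reg fx by simp
  have ph': "billiard_map \<rho> \<gamma> \<xi> \<in> phase_space \<rho>"
    and h: "hit_times \<rho> \<xi> \<noteq> {}" "hit_times \<rho> (billiard_map \<rho> \<gamma> \<xi>) \<noteq> {}"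
    using regular_phase_space(1)[OF \<rho> reg ph] regular_phase_space(4)[OF \<rho> reg ph, of \<gamma>]
      hit_times_reflect[OF \<rho>]
    unfolding T by auto
  \<comment> \<open>A regular state lies strictly to the left of the mirror line at
    \<open>1/2\<close>, so the reflection moves it.\<close>
  have "fst (reflect_state c \<xi>) $ 1 \<noteq> fst \<xi> $ 1"
    using reg by (cases \<xi>) (simp add: regular_def reflect_state_def)
  then have "billiard_map \<rho> \<gamma> \<xi> \<noteq> \<xi>"
    unfolding T by metis
  then show ?thesis
    using ph ph' h TT by (simp add: period_2_def billiard_dom_def)
qed

section \<open>Matrix representations and characteristic polynomials\<close>

lemma det_4:
  "det (A::'a::comm_ring_1^4^4) =
     A$1$1 * (A$2$2 * (A$3$3 * A$4$4 - A$3$4 * A$4$3) - A$2$3 * (A$3$2 * A$4$4 - A$3$4 * A$4$2) +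
              A$2$4 * (A$3$2 * A$4$3 - A$3$3 * A$4$2)) -
     A$1$2 * (A$2$1 * (A$3$3 * A$4$4 - A$3$4 * A$4$3) - A$2$3 * (A$3$1 * A$4$4 - A$3$4 * A$4$1) +
              A$2$4 * (A$3$1 * A$4$3 - A$3$3 * A$4$1)) +
     A$1$3 * (A$2$1 * (A$3$2 * A$4$4 - A$3$4 * A$4$2) - A$2$2 * (A$3$1 * A$4$4 - A$3$4 * A$4$1) +
              A$2$4 * (A$3$1 * A$4$2 - A$3$2 * A$4$1)) -
     A$1$4 * (A$2$1 * (A$3$2 * A$4$3 - A$3$3 * A$4$2) - A$2$2 * (A$3$1 * A$4$3 - A$3$3 * A$4$1) +
              A$2$3 * (A$3$1 * A$4$2 - A$3$2 * A$4$1))"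
proof -
  have f: "finite {2::4, 3, 4}" "1 \<notin> {2::4, 3, 4}" "finite {3::4, 4}" "2 \<notin> {3::4, 4}"
    "finite {4::4}" "3 \<notin> {4::4}"
    by auto
  show ?thesis
    unfolding det_def UNIV_4
    unfolding sum_over_permutations_insert[OF f(1,2)]
    unfolding sum_over_permutations_insert[OF f(3,4)]
    unfolding sum_over_permutations_insert[OF f(5,6)]
    unfolding permutes_sing
    by (simp add: sign_swap_id permutation_swap_id permutation_compose sign_compose sign_id
        swap_id_eq algebra_simps)
qed

text \<open>Having only trivial relations, indexed by \<open>'n\<close>, rules out repeated vectors
  as well; the dimension bound then turns independence into spanning.\<close>

lemma represents_onI:
  fixes b :: "'n::finite \<Rightarrow> 'a::euclidean_space"
  assumes indep: "\<And>u. (\<Sum>i\<in>UNIV. u i *\<^sub>R b i) = 0 \<Longrightarrow> \<forall>i. u i = 0"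
    and V: "range b \<subseteq> V" "subspace V" "dim V \<le> CARD('n)"
    and D: "\<And>j. D (b j) = (\<Sum>i\<in>UNIV. A $ i $ j *\<^sub>R b i)"
  shows "represents_on A D V"
proof -
  have inj: "inj b"
  proof (rule injI, rule ccontr)
    fix i j assume ij: "b i = b j" "i \<noteq> j"
    let ?u = "\<lambda>k. if k = i then 1 else if k = j then - 1 else (0::real)"
    have "(\<Sum>k\<in>UNIV. ?u k *\<^sub>R b k) = (\<Sum>k\<in>{i, j}. ?u k *\<^sub>R b k)"
      by (rule sum.mono_neutral_right) auto
    also have "\<dots> = 0" using ij by simp
    finally have "\<forall>k. ?u k = 0" by (rule indep)
    then show False by (metis zero_neq_one)
  qed
  have ind: "independent (range b)"
  proof (rule independent_if_scalars_zero)
    fix f x assume "(\<Sum>x\<in>range b. f x *\<^sub>R x) = 0" "x \<in> range b"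
    then have "(\<Sum>i\<in>UNIV. f (b i) *\<^sub>R b i) = 0"
      using inj by (simp add: sum.reindex)
    from indep[OF this] show "f x = 0" using \<open>x \<in> range b\<close> by auto
  qed simp
  have "card (range b) = CARD('n)" using inj by (simp add: card_image)
  then have "V \<subseteq> span (range b)"
    using V(1,3) ind by (intro card_ge_dim_independent) simp_all
  moreover have "span (range b) \<subseteq> V" using V by (simp add: span_minimal)
  ultimately have "span (range b) = V" by blast
  then show ?thesis
    unfolding represents_on_def using inj ind D by blast
qed

lemma tangent_space_subspace_dim:
  assumes "e3 \<rho> q \<noteq> 0" "v \<noteq> 0"
  shows "subspace (tangent_space \<rho> (q, v))" "dim (tangent_space \<rho> (q, v)) = 4"
proof -
  have eq: "tangent_space \<rho> (q, v) = {x. e3 \<rho> q \<bullet> x = 0} \<times> {x. v \<bullet> x = 0}"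
    by (auto simp: tangent_space_def inner_commute)
  show "subspace (tangent_space \<rho> (q, v))"
    unfolding eq by (intro subspace_Times subspace_hyperplane)
  show "dim (tangent_space \<rho> (q, v)) = 4"
    unfolding eq using assms
    by (simp add: dim_Times subspace_hyperplane dim_hyperplane)
qed

text \<open>This is the matrix of the squared derivative in the basis chosen in
  \<open>elliptic_0\<close>. Its lower block has trace -1 and determinant 1, so the remaining
  eigenvalues are the primitive cube roots of unity.\<close>

lemma root_of_unity_charpoly:
  fixes A :: "real^4^4"
  defines "A \<equiv> vector [vector [1, 0, 0, 0], vector [0, 1, 0, 0],
                       vector [0, 0, -1, 1], vector [0, 0, -1, 0]]"
  obtains \<mu> :: complex where "\<mu> \<notin> \<real>" "norm \<mu> = 1"
    "\<And>z. det (mat z - (\<chi> i j. complex_of_real (A $ i $ j))) = (z - 1)^2 * (z - \<mu>) * (z - cnj \<mu>)"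
proof -
  define \<mu> where "\<mu> = Complex (- 1/2) (sqrt 3 / 2)"
  have "Im \<mu> \<noteq> 0" by (simp add: \<mu>_def)
  then have 1: "\<mu> \<notin> \<real>" using complex_is_Real_iff by blast
  have 2: "norm \<mu> = 1" by (simp add: \<mu>_def complex_norm power_divide)
  have mm: "\<mu> + cnj \<mu> = -1" "\<mu> * cnj \<mu> = 1"
    by (simp_all add: \<mu>_def complex_eq_iff)
  have "det (mat z - (\<chi> i j. complex_of_real (A $ i $ j))) = (z - 1)^2 * (z^2 + z + 1)" for z
    unfolding det_4 A_def
    by (simp add: mat_def vector_def power2_eq_square algebra_simps)
  moreover have "(z - \<mu>) * (z - cnj \<mu>) = z^2 + z + 1" for z
    using mm by algebra
  ultimately show ?thesis
    using that[OF 1 2] by (simp add: mult.assoc)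
qed

section \<open>The elliptic orbit\<close>

locale sinai_orbit =
  fixes \<rho> \<gamma> a b h :: real
  assumes \<rho>: "0 < \<rho>" "\<rho> < 1/2" and \<gamma>: "0 < \<gamma>" "\<gamma> \<le> 1"
    and a: "2 * a = \<rho> * (1 + \<gamma>\<^sup>2)" and b: "b\<^sup>2 = 1 - a\<^sup>2" "0 < b"
    and h: "h\<^sup>2 = \<gamma>\<^sup>2 + b\<^sup>2" "0 < h"
begin

text \<open>\<open>L\<close> is the horizontal gap between the two collision points, and
  \<open>c\<close> is the rotational displacement over it at a velocity proportional to
  \<open>(\<gamma>, 0, b)\<close>.\<close>

definition "L = 1 - 2 * \<rho> * a"
definition "c = L * b / \<gamma>"
definition q0 :: "real^3" where "q0 = vector [\<rho> * a, \<rho> * b, 0]"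
text \<open>The spin is balanced against the horizontal speed so that \<open>v0\<close> is
  orthogonal to the collision axes at both ends.\<close>

definition v0 :: "real^3" where "v0 = vector [\<gamma> / h, 0, b / h]"

lemma q0_simps [simp]: "q0 $ 1 = \<rho> * a" "q0 $ 2 = \<rho> * b" "q0 $ 3 = 0"
  and v0_simps [simp]: "v0 $ 1 = \<gamma> / h" "v0 $ 2 = 0" "v0 $ 3 = b / h"
  by (simp_all add: q0_def v0_def)

lemma a_bounds: "0 < a" "a < 1/2"
proof -
  have "0 < \<rho> * (1 + \<gamma>\<^sup>2)" using \<rho> by (simp add: add_pos_nonneg)
  then show "0 < a" using a by simp
  have "\<rho> * (1 + \<gamma>\<^sup>2) \<le> \<rho> * (1 + 1)"
    using \<rho> \<gamma> by (intro mult_left_mono add_left_mono) (simp_all add: power_le_one)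
  then have "2 * a \<le> \<rho> * 2" unfolding a by simp
  then show "a < 1/2" using \<rho> by linarith
qed

lemma L_pos: "0 < L"
proof -
  have "\<rho> * a < 1/2 * (1/2)" using \<rho> a_bounds by (intro mult_strict_mono) simp_all
  then show ?thesis by (simp add: L_def)
qed

lemma speed2_0: "speed2 (q0, v0) = (\<gamma> / h)\<^sup>2"
  and approach_0: "approach (q0, v0) = (\<rho> * a - 1) * (\<gamma> / h)"
  by (simp_all add: speed2_def approach_def)

lemma discr_0: "discr \<rho> (q0, v0) = (\<rho> * a * (\<gamma> / h))\<^sup>2"
proof -
  have "((\<rho> * a - 1) * g)\<^sup>2 - g\<^sup>2 * ((\<rho> * a - 1)\<^sup>2 + (\<rho> * b)\<^sup>2 - \<rho>\<^sup>2) = (\<rho> * a * g)\<^sup>2" for g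
    using b(1) by algebra
  then show ?thesis
    unfolding discr_def speed2_0 approach_0 fst_conv q0_simps .
qed

lemma flight_0: "flight \<rho> (q0, v0) = L * h / \<gamma>"
proof -
  have "sqrt (discr \<rho> (q0, v0)) = \<rho> * a * (\<gamma> / h)"
    unfolding discr_0 using \<rho> \<gamma> a_bounds h(2) by (simp add: real_sqrt_abs)
  then show ?thesis
    using \<gamma> h(2) unfolding flight_def speed2_0 approach_0 L_def
    by (simp add: field_simps power2_eq_square)
qed

lemma landing_0: "landing \<rho> c (q0, v0) = q0"
  using \<gamma> h(2) by (simp add: landing_def flight_0 vec_eq_iff forall_3 c_def L_def)

lemma regular_0: "regular \<rho> c (q0, v0)"
proof -
  have "0 < b" "b < 1"
    using b a_bounds by (auto intro: power2_less_imp_less[of b 1])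
  then have "\<rho> * a < 1/2" "\<rho> * b < 1/2" "0 < \<rho> * b" "0 < \<rho> * a"
    using \<rho> a_bounds mult_strict_mono[of \<rho> "1/2" b 1] mult_strict_mono[of \<rho> "1/2" a 1] by simp_all
  moreover have "0 < (\<gamma> / h)\<^sup>2" "0 < (\<rho> * a * (\<gamma> / h))\<^sup>2" "0 < L * h / \<gamma>"
    using \<gamma> h(2) \<rho> a_bounds L_pos by simp_all
  ultimately show ?thesis
    unfolding regular_def speed2_0 discr_0 flight_0 landing_0 by simp
qed

lemma norm_v0: "norm v0 = 1"
proof -
  have "v0 \<bullet> v0 = (\<gamma>\<^sup>2 + b\<^sup>2) / h\<^sup>2"
    by (simp add: inner_vec_def sum_3 power2_eq_square add_divide_distrib)
  also have "\<dots> = 1" unfolding h(1)[symmetric] using h(2) by simp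
  finally show ?thesis by (simp add: norm_eq_sqrt_inner)
qed

lemma q0_circle: "(q0$1)\<^sup>2 + (q0$2)\<^sup>2 = \<rho>\<^sup>2"
  unfolding q0_simps using b(1) by algebra

lemma phase_space_0: "(q0, v0) \<in> phase_space \<rho>"
proof -
  have "q0$1 * v0$1 + q0$2 * v0$2 > 0"
    using \<rho> \<gamma> h(2) a_bounds by simp
  then show ?thesis
    unfolding phase_space_iff[OF \<rho>] using q0_circle norm_v0
    by (intro conjI bexI[of _ 0]) (simp_all add: lattice_def)
qed

lemma fixed_dir_0: "fixed_dir \<rho> \<gamma> 0 q0 = vector [b, - a, - \<gamma>]"
  using \<rho> by (simp add: fixed_dir_def vec_eq_iff forall_3)

lemma fixed_dir_orth: "fixed_dir \<rho> \<gamma> 0 q0 \<bullet> flip v0 = 0"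
  by (simp add: fixed_dir_0 inner_vec_def sum_3)

text \<open>A velocity orthogonal to the axis is negated by the half turn, and \<open>flip\<close>
  negates \<open>v0\<close> because it has no vertical component; the two signs cancel.\<close>

lemma return_map_0: "return_map \<rho> \<gamma> c (q0, v0) = (q0, v0)"
  by (simp add: return_map_def landing_0 half_turn_def fixed_dir_orth)
    (simp add: vec_eq_iff forall_3)

text \<open>Coordinates on the tangent space at \<open>(q0, v0)\<close>, scaled so that the square root \<open>h\<close> enters the
  derivative of the return map only through \<open>h\<^sup>2\<close>.\<close>

definition tangent :: "real \<Rightarrow> real \<Rightarrow> real \<Rightarrow> real \<Rightarrow> state" where
  "tangent y f g s = (vector [b * y, - a * y, s], (\<gamma> / h) *\<^sub>R vector [b * g, a * f, - \<gamma> * g])"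

lemma tangent_simps:
  "tangent y f g s + tangent y' f' g' s' = tangent (y + y') (f + f') (g + g') (s + s')"
  "r *\<^sub>R tangent y f g s = tangent (r * y) (r * f) (r * g) (r * s)"
  "- tangent y f g s = tangent (- y) (- f) (- g) (- s)"
  using h(2) by (simp_all add: tangent_def vec_eq_iff forall_3 field_simps)

lemma tangent_eq_0_iff: "tangent y f g s = 0 \<longleftrightarrow> y = 0 \<and> f = 0 \<and> g = 0 \<and> s = 0"
  using b(2) a_bounds \<gamma> h(2)
  by (auto simp: tangent_def vec_eq_iff forall_3 zero_prod_def)

lemma e3_0: "e3 \<rho> q0 = vector [a, b, 0]"
proof -
  have "e3 \<rho> q0 = vector [(q0$1 - (0::real^2)$1) / \<rho>, (q0$2 - (0::real^2)$2) / \<rho>, 0]"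
    using q0_circle by (intro e3_eq[OF \<rho>]) (simp_all add: lattice_def)
  then show ?thesis using \<rho> by simp
qed

lemma tangent_in_tangent_space: "tangent y f g s \<in> tangent_space \<rho> (q0, v0)"
  by (simp add: tangent_space_def tangent_def e3_0 inner_vec_def sum_3)

text \<open>Tangency of the landing point to the circle determines the variation of the flight time,
  hence the new position; the product rule for the half turn then gives the new velocity.\<close>

lemma derivative_return_map:
  obtains D where "(return_map \<rho> \<gamma> c has_derivative D) (at (q0, v0))"
    and "\<And>y f g s. D (tangent y f g s) = tangent (y - L * f)
       (- y - \<rho> * a * f + (2 - \<rho> * a) * g) (y - (1 - \<rho> * a) * g - (1 - \<rho> * a) * f)
       (- s + (h\<^sup>2 * L * g + 2 * b\<^sup>2 * y - b\<^sup>2 * L * f) / \<gamma>)"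
proof -
  have sd: "speed2 (q0, v0) > 0" "discr \<rho> (q0, v0) > 0"
    using regular_0 by (simp_all add: regular_def)
  define t where "t = flight \<rho> (q0, v0)"
  define W where "W = fixed_dir \<rho> \<gamma> 0 q0"
  obtain \<tau> where
    D: "(return_map \<rho> \<gamma> c has_derivative return_deriv \<rho> \<gamma> c (q0, v0) \<tau>) (at (q0, v0))"
    and \<tau>: "\<And>\<delta>. landing \<rho> c (q0, v0) $ 1 * landing_deriv \<rho> (q0, v0) \<tau> \<delta> $ 1 +
       landing \<rho> c (q0, v0) $ 2 * landing_deriv \<rho> (q0, v0) \<tau> \<delta> $ 2 = 0"
    using return_map_has_derivative[OF sd] by blast
  let ?D = "return_deriv \<rho> \<gamma> c (q0, v0) \<tau>"
  have "?D (tangent y f g s) = tangent (y - L * f)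
       (- y - \<rho> * a * f + (2 - \<rho> * a) * g) (y - (1 - \<rho> * a) * g - (1 - \<rho> * a) * f)
       (- s + (h\<^sup>2 * L * g + 2 * b\<^sup>2 * y - b\<^sup>2 * L * f) / \<gamma>)" for y f g s
  proof -
    \<comment> \<open>\<open>r\<close> is the unknown first-order change of the flight time, scaled
      by \<open>1 / h\<close>; \<open>y'\<close> will be the tangential coordinate of the
      image.\<close>
    define r where "r = \<tau> (tangent y f g s) / h"
    define y' where "y' = y - L * f"
    define Y where "Y = landing_deriv \<rho> (q0, v0) \<tau> (tangent y f g s)"
    have tg: "t * (\<gamma> / h) = L" using \<gamma> h(2) by (simp add: t_def flight_0)
    have Y: "Y$1 = - (b * y + L * b * g + r * \<gamma>)" "Y$2 = - (a * y')"
      "Y$3 = - (s - L * \<gamma> * g + r * b)"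
      using tg by (simp_all add: Y_def landing_deriv_def t_def[symmetric] tangent_def r_def y'_def mult.assoc[symmetric])
        (simp_all add: algebra_simps)
    \<comment> \<open>\<open>Y\<close> is orthogonal to the normal \<open>(a, b)\<close>. As
      \<open>Y$2\<close> is free of \<open>r\<close>, this gives \<open>Y$1\<close>, and comparison
      with the direct formula for \<open>Y$1\<close> solves for \<open>r\<close>.\<close>
    have "\<rho> * (a * Y$1 + b * Y$2) = 0"
      using \<tau>[of "tangent y f g s", folded Y_def] by (simp add: landing_0 algebra_simps)
    then have "a * (Y$1 - b * y') = 0"
      using \<rho> Y(2) by (simp add: algebra_simps)
    then have Y1: "Y$1 = b * y'" using a_bounds by simp
    then have "r * \<gamma> = - b * (2 * y + L * g - L * f)"
      using Y(1) by (simp add: y'_def algebra_simps)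
    then have r: "r = - b * (2 * y + L * g - L * f) / \<gamma>"
      using \<gamma> by (simp add: field_simps)
    have "L * \<gamma> * g + b\<^sup>2 * (2 * y + L * g - L * f) / \<gamma> =
        (h\<^sup>2 * L * g + 2 * b\<^sup>2 * y - b\<^sup>2 * L * f) / \<gamma>"
      unfolding h(1) using \<gamma> by (simp add: field_simps power2_eq_square)
    then have Y3: "Y$3 = - s + (h\<^sup>2 * L * g + 2 * b\<^sup>2 * y - b\<^sup>2 * L * f) / \<gamma>"
      unfolding Y(3) r by (simp add: power2_eq_square mult_ac)
    define m where "m = y' - \<rho> * a * f - (2 - \<rho> * a) * g"
    have "1 + \<gamma>\<^sup>2 \<noteq> 0" by (smt (verit) zero_le_power2)
    then have k: "2 / (1 + \<gamma>\<^sup>2) = \<rho> / a"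
      using a a_bounds by (simp add: frac_eq_eq)
    \<comment> \<open>Here the special choice of \<open>a\<close> enters, together with
      \<open>h\<^sup>2 = \<gamma>\<^sup>2 + 1 - a\<^sup>2\<close>; it removes
      \<open>h\<^sup>2\<close> from the velocity coordinates.\<close>
    have rh: "\<rho> * h\<^sup>2 = a * (2 - \<rho> * a)"
      using a h(1) b(1) by algebra
    have w: "W \<bullet> flip (snd (tangent y f g s)) = - (\<gamma> / h) * (h\<^sup>2 * g + a\<^sup>2 * f)"
      unfolding W_def fixed_dir_0 h(1)
      by (simp add: tangent_def inner_vec_def sum_3 power2_eq_square algebra_simps)
    have s: "spin \<rho> Y \<bullet> flip v0 = (\<gamma> / h) * (a * y' / \<rho>)"
      by (simp add: spin_def inner_vec_def sum_3 Y mult_ac)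
    have "2 / (1 + \<gamma>\<^sup>2) * (W \<bullet> flip (snd (tangent y f g s)) + spin \<rho> Y \<bullet> flip v0) =
        (\<gamma> / h) * (\<rho> / a * (a * y' / \<rho> - h\<^sup>2 * g - a\<^sup>2 * f))"
      unfolding k w s by (simp add: algebra_simps)
    also have "\<rho> / a * (a * y' / \<rho> - h\<^sup>2 * g - a\<^sup>2 * f) = y' - \<rho> * h\<^sup>2 * g / a - \<rho> * a * f"
      using \<rho> a_bounds by (simp add: field_simps power2_eq_square)
    also have "\<dots> = m"
      unfolding rh m_def using a_bounds by simp
    finally have coef: "2 / (1 + \<gamma>\<^sup>2) * (W \<bullet> flip (snd (tangent y f g s)) + spin \<rho> Y \<bullet> flip v0) =
        (\<gamma> / h) * m" .
    have "?D (tangent y f g s) = (Y, (\<gamma> / h * m) *\<^sub>R W - flip (snd (tangent y f g s)))"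
      unfolding return_deriv_def Let_def Y_def[symmetric] landing_0 snd_conv W_def[symmetric] coef
      by (simp add: W_def fixed_dir_orth)
    also have "Y = vector [b * y', - a * y', - s + (h\<^sup>2 * L * g + 2 * b\<^sup>2 * y - b\<^sup>2 * L * f) / \<gamma>]"
      using Y1 Y(2) Y3 by (simp add: vec_eq_iff forall_3)
    also have "(\<gamma> / h * m) *\<^sub>R W - flip (snd (tangent y f g s)) =
        (\<gamma> / h) *\<^sub>R vector [b * (m + g), a * (- m - f), - \<gamma> * (m + g)]"
      by (simp add: W_def fixed_dir_0 tangent_def vec_eq_iff forall_3)
        (simp add: algebra_simps add_divide_distrib diff_divide_distrib)
    also have "m + g = y - (1 - \<rho> * a) * g - (1 - \<rho> * a) * f"
      by (simp add: m_def y'_def L_def algebra_simps)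
    also have "- m - f = - y - \<rho> * a * f + (2 - \<rho> * a) * g"
      by (simp add: m_def y'_def L_def algebra_simps)
    finally show ?thesis
      by (simp add: tangent_def y'_def)
  qed
  then show ?thesis using that D by blast
qed

lemma elliptic_0: "elliptic \<rho> \<gamma> (q0, v0)"
proof -
  obtain D where D: "(return_map \<rho> \<gamma> c has_derivative D) (at (q0, v0))"
    and Dt: "\<And>y f g s. D (tangent y f g s) = tangent (y - L * f)
       (- y - \<rho> * a * f + (2 - \<rho> * a) * g) (y - (1 - \<rho> * a) * g - (1 - \<rho> * a) * f)
       (- s + (h\<^sup>2 * L * g + 2 * b\<^sup>2 * y - b\<^sup>2 * L * f) / \<gamma>)"
    by (rule derivative_return_map) blast
  \<comment> \<open>These are the rotational components of \<open>D b2\<close> and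
    \<open>D b3\<close>, read off from \<open>Dt\<close>; with \<open>s4\<close>, the vector
    \<open>b4\<close> is exactly \<open>D b3\<close>.\<close>
  define s2 s4 where "s2 = (h\<^sup>2 * L + 2 * b\<^sup>2 * (2 - \<rho> * a)) / \<gamma>"
    and "s4 = - (L * (h\<^sup>2 + b\<^sup>2)) / \<gamma>"
  \<comment> \<open>\<open>b1\<close> shifts the rotation coordinate, \<open>b2\<close> is tangent to the family of period-2 orbits up to
    a multiple of \<open>b1\<close>, and \<open>b3\<close>, \<open>b4\<close> span the plane on which \<open>D\<close> has order 3.\<close>
  define b1 b2 b3 b4 where "b1 = tangent 0 0 0 1" and "b2 = tangent (2 - \<rho> * a) 0 1 0"
    and "b3 = tangent 0 1 (-1) 0" and "b4 = tangent (- L) (-2) 0 s4"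
  note bs = b1_def b2_def b3_def b4_def
  have lin: "linear D" using D by (rule has_derivative_linear)
  have D1: "D b1 = - b1" and D2: "D b2 = b2 + s2 *\<^sub>R b1" and D3: "D b3 = b4" and D4: "D b4 = - b3 - b4"
    unfolding bs Dt diff_conv_add_uminus tangent_simps
    by (auto intro!: arg_cong4[where f = tangent] simp: s2_def s4_def L_def algebra_simps
        diff_divide_distrib add_divide_distrib)
  define A :: "real^4^4" where "A = vector [vector [1, 0, 0, 0], vector [0, 1, 0, 0],
                       vector [0, 0, -1, 1], vector [0, 0, -1, 0]]"
  define B :: "4 \<Rightarrow> state" where "B = (\<lambda>i. if i = 1 then b1 else if i = 2 then b2 else if i = 3 then b3 else b4)"
  have "represents_on A (D \<circ> D) (tangent_space \<rho> (q0, v0))"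
  proof (rule represents_onI)
    fix u :: "4 \<Rightarrow> real" assume "(\<Sum>i\<in>UNIV. u i *\<^sub>R B i) = 0"
    then have "tangent (u 2 * (2 - \<rho> * a) - u 4 * L) (u 3 - 2 * u 4) (u 2 - u 3) (u 1 + u 4 * s4) = 0"
      by (simp add: sum_4 B_def bs tangent_simps mult.commute)
    then have u: "u 2 * (2 - \<rho> * a) - u 4 * L = 0" "u 3 - 2 * u 4 = 0" "u 2 - u 3 = 0" "u 1 + u 4 * s4 = 0"
      unfolding tangent_eq_0_iff by blast+
    then have u23: "u 2 = 2 * u 4" "u 3 = 2 * u 4"
      by simp_all
    \<comment> \<open>The terms in \<open>\<rho> * a\<close> cancel and leave
      \<open>3 * u 4 = 0\<close>.\<close>
    have "2 * u 4 * (2 - \<rho> * a) - u 4 * (1 - 2 * \<rho> * a) = 0"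
      using u(1) unfolding u23 L_def .
    then have "u 4 = 0"
      by (simp add: algebra_simps)
    with u(4) u23 show "\<forall>i. u i = 0" by (simp add: forall_4)
  next
    show "range B \<subseteq> tangent_space \<rho> (q0, v0)"
      by (auto simp: B_def bs tangent_in_tangent_space)
    have "e3 \<rho> q0 \<noteq> 0"
      using a_bounds(1) by (simp add: e3_0 vec_eq_iff forall_3)
    moreover have "v0 \<noteq> 0"
      using norm_v0 by force
    ultimately show "subspace (tangent_space \<rho> (q0, v0))" "dim (tangent_space \<rho> (q0, v0)) \<le> CARD(4)"
      by (simp_all add: tangent_space_subspace_dim)
    \<comment> \<open>The shear of \<open>b2\<close> along \<open>b1\<close> cancels in the square
      because \<open>D b1 = - b1\<close>; on \<open>b3\<close>, \<open>b4\<close> the square is the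
      inverse of the order-3 map.\<close>
    have "(D \<circ> D) b1 = b1" "(D \<circ> D) b2 = b2" "(D \<circ> D) b3 = - b3 - b4" "(D \<circ> D) b4 = b3"
      using lin by (simp_all add: D1 D2 D3 D4 linear_add linear_scale linear_neg linear_diff)
    then show "(D \<circ> D) (B j) = (\<Sum>i\<in>UNIV. A $ i $ j *\<^sub>R B i)" for j
      using exhaust_4[of j] by (auto simp: sum_4 B_def A_def vector_def)
  qed
  moreover have "((\<lambda>\<eta>. billiard_map \<rho> \<gamma> (billiard_map \<rho> \<gamma> \<eta>)) has_derivative (D \<circ> D))
      (at (q0, v0) within phase_space \<rho>)"
    by (rule billiard_map_twice_has_derivative[OF \<rho> regular_0 phase_space_0 return_map_0 D])
  moreover obtain \<mu> :: complex where "\<mu> \<notin> \<real>" "norm \<mu> = 1"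
    "\<And>z. det (mat z - (\<chi> i j. complex_of_real (A $ i $ j))) = (z - 1)^2 * (z - \<mu>) * (z - cnj \<mu>)"
    using root_of_unity_charpoly unfolding A_def by blast
  ultimately show ?thesis
    unfolding elliptic_def by blast
qed

end

theorem proposition9p3:
  fixes \<rho> \<gamma> :: real
  assumes "0 < \<rho>" "\<rho> < 1/2" "0 < \<gamma>" "\<gamma> \<le> 1"
  shows "\<exists>\<xi>. period_2 \<rho> \<gamma> \<xi> \<and> elliptic \<rho> \<gamma> \<xi>"
proof -
  define a where "a = \<rho> * (1 + \<gamma>\<^sup>2) / 2"
  \<comment> \<open>These bounds give \<open>a < 1/2\<close>, so the radicand of \<open>b\<close> is
    positive.\<close>
  have "1 + \<gamma>\<^sup>2 \<le> 2" using assms by (simp add: power_le_one)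
  then have "\<rho> * (1 + \<gamma>\<^sup>2) < 1/2 * 2" using assms by (intro mult_less_le_imp_less) (simp_all add: add_pos_nonneg)
  moreover have "0 \<le> a" using assms by (simp add: a_def)
  ultimately have a: "a\<^sup>2 < 1" by (simp add: a_def power_less_one_iff abs_square_less_1)
  define b where "b = sqrt (1 - a\<^sup>2)"
  define h where "h = sqrt (\<gamma>\<^sup>2 + b\<^sup>2)"
  interpret sinai_orbit \<rho> \<gamma> a b h
    using assms a by unfold_locales (simp_all add: a_def b_def h_def add_pos_pos)
  show ?thesis
    using regular_fixed_point_period_2[OF \<rho> regular_0 phase_space_0 return_map_0] elliptic_0 by blast
qed

end
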